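(* Let $\Omega_1\subseteq\mathbb{R}^2$ be a simply connected planar domain, let $\psi:\Omega_1\to\mathbb{R}^3$, $\psi(x,y)=(x,y,u(x,y))$, be a $[\varphi,\vec e_3]$-minimal graph in $\mathbb{R}^3$, let $W=\sqrt{1+u_x^2+u_y^2}$, let $\phi:\Omega_1\to\mathbb{R}$ be a solution of the system $$\phi_{xx}=\frac{1+u_x^2}{W}e^{\varphi(u)},\qquad \phi_{xy}=\frac{u_xu_y}{W}e^{\varphi(u)},\qquad \phi_{yy}=\frac{1+u_y^2}{W}e^{\varphi(u)},$$ and let $\vartheta$ be a primitive of $e^{\varphi}$ (that is, $\dot\vartheta=e^{\varphi}$). Then $\widetilde\psi:\Omega_1\to\mathbb{L}^3$ given by $$\widetilde\psi:=(\phi_x,\phi_y,\vartheta(u))$$ is a $[-\varphi\circ\vartheta^{-1},\vec e_3]$-maximal spacelike graph in the Lorentz-Minkowski space $\mathbb{L}^3$ whose Gauss map is $$\widetilde N=(u_x,u_y,W).$$ The induced metrics $g$ and $\widetilde g$ of $\psi$ and $\widetilde\psi$, respectively, are conformal, and the mean curvatures $H$, $\widetilde H$ and Gauss curvatures $K$, $\widetilde K$ of $\psi$, $\widetilde\psi$ respectively satisfy $$\widetilde H+W^2e^{-\varphi(u)}H=0,\qquad \widetilde K+W^4e^{-2\varphi(u)}K=0.$$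
   Context: Let $\vec e_3=(0,0,1)$. $\mathbb{L}^3$ is $\mathbb{R}^3$ with the Lorentz metric $\ll\cdot,\cdot\gg=dx^2+dy^2-dz^2$; a surface in $\mathbb{L}^3$ is spacelike if its induced metric is positive definite. A graph is a surface that is the vertical graph of a function on a planar domain; for $\widetilde\psi$ this domain is the Legendre transform domain of $\phi$, i.e. the image of $(x,y)\mapsto(\phi_x,\phi_y)$. Here $\varphi$ is a smooth function depending only on the third coordinate; a dot denotes the derivative with respect to that coordinate. Mean curvature vectors are traces of the vector-valued second fundamental form (equivalently, the Laplacian of the immersion in the induced metric). A surface in $\mathbb{R}^3$ is $[\varphi,\vec e_3]$-minimal if its mean curvature vector is $\mathbf H=(\overline\nabla\varphi)^\perp=\dot\varphi\,\vec e_3^{\perp}$, where $\perp$ is the projection to the normal bundle. For a graph $(x,y,u)$ this is equivalent to $(1+u_x^2)u_{yy}+(1+u_y^2)u_{xx}-2u_xu_yu_{xy}=\dot\varphi(u)W^2$, which is the integrability condition of the system for $\phi$ ($\phi$ is convex and unique modulo linear polynomials). A spacelike surface in $\mathbb{L}^3$ is $[\varphi,\vec e_3]$-maximal if its mean curvature vector is $\widetilde{\mathbf H}=(\overline\nabla^{\mathbb{L}^3}\varphi)^\perp$, where $\overline\nabla^{\mathbb{L}^3}$ is the gradient in $\mathbb{L}^3$. The Gauss map of $\psi$ is $N=\frac1W(-u_x,-u_y,1)$. The shape operators are $A=-dN$ and $\widetilde A=-d\widetilde N$; the mean curvatures are $H=\mathrm{tr}\,A$, $\widetilde H=\mathrm{tr}\,\widetilde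 A$; the Gauss curvatures are those of the induced Riemannian metrics, so $K=\det A$ and $\widetilde K=-\det\widetilde A$.
   Formalization: The surface is shown to be locally a graph for every simply connected domain, and globally a graph over the Legendre transform domain when the domain is convex or φ is the restriction of a convex function on its convex hull; a tilted catenoid over a slit annulus refutes the unrestricted claim. *)

theory Defs
  imports "HOL-Analysis.Analysis"
begin

text \<open>On open sets, \<open>Ck_on k S f\<close> is the usual class \<open>C\<^sup>k\<close>: the derivative exists and all
  its directional components are of class \<open>C\<^sup>k\<^sup>-\<^sup>1\<close>.\<close>

primrec Ck_on :: "nat \<Rightarrow> 'a::real_normed_vector set \<Rightarrow> ('a \<Rightarrow> 'b::real_normed_vector) \<Rightarrow> bool" where
  "Ck_on 0 S f \<longleftrightarrow> continuous_on S f"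
| "Ck_on (Suc k) S f \<longleftrightarrow> (\<forall>x\<in>S. f differentiable (at x)) \<and>
     (\<forall>v. Ck_on k S (\<lambda>x. frechet_derivative f (at x) v))"

definition smooth_on :: "'a::real_normed_vector set \<Rightarrow> ('a \<Rightarrow> 'b::real_normed_vector) \<Rightarrow> bool" where
  "smooth_on S f \<longleftrightarrow> (\<forall>k. Ck_on k S f)"

definition partial_deriv :: "2 \<Rightarrow> (real^2 \<Rightarrow> 'b::real_normed_vector) \<Rightarrow> real^2 \<Rightarrow> 'b" ("\<partial>") where
  "\<partial> i f p = frechet_derivative f (at p) (axis i 1)"

definition planar_domain :: "(real^2) set \<Rightarrow> bool" where
  "planar_domain D \<longleftrightarrow> open D \<and> connected D \<and> D \<noteq> {}"

text \<open>The ambient metric is a parameter \<open>B\<close>: the inner product gives \<open>\<real>\<^sup>3\<close>, and the form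
  \<open>lorentz\<close> gives \<open>\<bbbL>\<^sup>3\<close>. Since both metrics are constant, the ambient connection is
  differentiation of components. Tangent vectors of the surface are represented by vectors of the
  parameter plane.\<close>

definition lorentz :: "real^3 \<Rightarrow> real^3 \<Rightarrow> real" where
  "lorentz v w = v$1 * w$1 + v$2 * w$2 - v$3 * w$3"

definition induced_metric :: "(real^3 \<Rightarrow> real^3 \<Rightarrow> real) \<Rightarrow> (real^2 \<Rightarrow> real^3) \<Rightarrow> real^2 \<Rightarrow> real^2^2" where
  "induced_metric B \<psi> p = (\<chi> i j. B (\<partial> i \<psi> p) (\<partial> j \<psi> p))"

definition positive_definite :: "real^2^2 \<Rightarrow> bool" where
  "positive_definite g \<longleftrightarrow> (\<forall>v. v \<noteq> 0 \<longrightarrow> v \<bullet> (g *v v) > 0)"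

definition normal_part ::
  "(real^3 \<Rightarrow> real^3 \<Rightarrow> real) \<Rightarrow> (real^2 \<Rightarrow> real^3) \<Rightarrow> real^2 \<Rightarrow> real^3 \<Rightarrow> real^3" where
  "normal_part B \<psi> p w = (THE n. w - n \<in> range (frechet_derivative \<psi> (at p)) \<and>
     (\<forall>v. B n (frechet_derivative \<psi> (at p) v) = 0))"

definition second_fundamental_form ::
  "(real^3 \<Rightarrow> real^3 \<Rightarrow> real) \<Rightarrow> (real^2 \<Rightarrow> real^3) \<Rightarrow> real^2 \<Rightarrow> 2 \<Rightarrow> 2 \<Rightarrow> real^3" where
  "second_fundamental_form B \<psi> p i j = normal_part B \<psi> p (\<partial> i (\<partial> j \<psi>) p)"

definition mean_curvature_vector ::
  "(real^3 \<Rightarrow> real^3 \<Rightarrow> real) \<Rightarrow> (real^2 \<Rightarrow> real^3) \<Rightarrow> real^2 \<Rightarrow> real^3" where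
  "mean_curvature_vector B \<psi> p =
     (\<Sum>i\<in>UNIV. \<Sum>j\<in>UNIV. matrix_inv (induced_metric B \<psi> p) $ i $ j *\<^sub>R second_fundamental_form B \<psi> p i j)"

definition ambient_gradient ::
  "(real^3 \<Rightarrow> real^3 \<Rightarrow> real) \<Rightarrow> (real^3 \<Rightarrow> real) \<Rightarrow> real^3 \<Rightarrow> real^3" where
  "ambient_gradient B F x = (THE w. \<forall>v. B w v = frechet_derivative F (at x) v)"

text \<open>The potential is a function of the third coordinate only, defined on an open interval \<open>I\<close>
  containing the heights of the surface; \<open>I = UNIV\<close> is allowed. For the inner product, positive
  definiteness of the induced metric says exactly that \<open>\<psi>\<close> is an immersion; for \<open>lorentz\<close> it says
  that \<open>\<psi>\<close> is a spacelike immersion.\<close>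

definition weighted_extremal ::
  "(real^3 \<Rightarrow> real^3 \<Rightarrow> real) \<Rightarrow> real set \<Rightarrow> (real \<Rightarrow> real) \<Rightarrow> (real^2) set \<Rightarrow> (real^2 \<Rightarrow> real^3) \<Rightarrow> bool" where
  "weighted_extremal B I \<phi> \<Omega> \<psi> \<longleftrightarrow>
     open I \<and> is_interval I \<and> smooth_on I \<phi> \<and> smooth_on \<Omega> \<psi> \<and>
     (\<forall>p\<in>\<Omega>. positive_definite (induced_metric B \<psi> p) \<and> \<psi> p $ 3 \<in> I \<and>
        mean_curvature_vector B \<psi> p = normal_part B \<psi> p (ambient_gradient B (\<lambda>x. \<phi> (x $ 3)) (\<psi> p)))"

definition minimal_surface ::
  "real set \<Rightarrow> (real \<Rightarrow> real) \<Rightarrow> (real^2) set \<Rightarrow> (real^2 \<Rightarrow> real^3) \<Rightarrow> bool" where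
  "minimal_surface = weighted_extremal (\<bullet>)"

definition maximal_spacelike_surface ::
  "real set \<Rightarrow> (real \<Rightarrow> real) \<Rightarrow> (real^2) set \<Rightarrow> (real^2 \<Rightarrow> real^3) \<Rightarrow> bool" where
  "maximal_spacelike_surface = weighted_extremal lorentz"

text \<open>The orientation is fixed by a positive third coordinate: upward in \<open>\<real>\<^sup>3\<close>, future-directed
  in \<open>\<bbbL>\<^sup>3\<close>. The normal of a spacelike surface satisfies \<open>lorentz n n = -1\<close>.\<close>

definition is_gauss_map ::
  "(real^3 \<Rightarrow> real^3 \<Rightarrow> real) \<Rightarrow> (real^2) set \<Rightarrow> (real^2 \<Rightarrow> real^3) \<Rightarrow> (real^2 \<Rightarrow> real^3) \<Rightarrow> bool" where
  "is_gauss_map B \<Omega> \<psi> N \<longleftrightarrow>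
     (\<forall>p\<in>\<Omega>. (\<forall>v. B (N p) (frechet_derivative \<psi> (at p) v) = 0) \<and> \<bar>B (N p) (N p)\<bar> = 1 \<and> N p $ 3 > 0)"

definition shape_operator :: "(real^2 \<Rightarrow> real^3) \<Rightarrow> (real^2 \<Rightarrow> real^3) \<Rightarrow> real^2 \<Rightarrow> real^2^2" where
  "shape_operator \<psi> N p =
     (THE A. \<forall>v. frechet_derivative \<psi> (at p) (A *v v) = - frechet_derivative N (at p) v)"

definition mean_curvature :: "(real^2 \<Rightarrow> real^3) \<Rightarrow> (real^2 \<Rightarrow> real^3) \<Rightarrow> real^2 \<Rightarrow> real" where
  "mean_curvature \<psi> N p = trace (shape_operator \<psi> N p)"

text \<open>The parametrization need not be by the horizontal coordinates: these only have to map the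
  parameter domain bijectively onto \<open>D\<close>.\<close>

definition vertical_graph_over ::
  "(real^2) set \<Rightarrow> (real^2 \<Rightarrow> real) \<Rightarrow> (real^2) set \<Rightarrow> (real^2 \<Rightarrow> real^3) \<Rightarrow> bool" where
  "vertical_graph_over D f \<Omega> \<psi> \<longleftrightarrow> planar_domain D \<and> smooth_on D f \<and>
     bij_betw (\<lambda>p. vector [\<psi> p $ 1, \<psi> p $ 2]) \<Omega> D \<and>
     (\<forall>p\<in>\<Omega>. \<psi> p $ 3 = f (vector [\<psi> p $ 1, \<psi> p $ 2]))"

definition conformal_metrics :: "(real^2) set \<Rightarrow> (real^2 \<Rightarrow> real^2^2) \<Rightarrow> (real^2 \<Rightarrow> real^2^2) \<Rightarrow> bool" where
  "conformal_metrics \<Omega> g g' \<longleftrightarrow>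
     (\<exists>l. smooth_on \<Omega> l \<and> (\<forall>p\<in>\<Omega>. l p > 0 \<and> g' p = l p *\<^sub>R g p))"

definition christoffel :: "(real^2 \<Rightarrow> real^2^2) \<Rightarrow> 2 \<Rightarrow> 2 \<Rightarrow> 2 \<Rightarrow> real^2 \<Rightarrow> real" where
  "christoffel g l i j p = (\<Sum>m\<in>UNIV. matrix_inv (g p) $ l $ m *
     (\<partial> i (\<lambda>q. g q $ j $ m) p + \<partial> j (\<lambda>q. g q $ i $ m) p - \<partial> m (\<lambda>q. g q $ i $ j) p)) / 2"

text \<open>\<open>riemann g l k i j\<close> is the component along \<open>\<partial>\<^sub>l\<close> of
  \<open>R(\<partial>\<^sub>i, \<partial>\<^sub>j) \<partial>\<^sub>k = \<nabla>\<^sub>i \<nabla>\<^sub>j \<partial>\<^sub>k - \<nabla>\<^sub>j \<nabla>\<^sub>i \<partial>\<^sub>k\<close>.\<close>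

definition riemann :: "(real^2 \<Rightarrow> real^2^2) \<Rightarrow> 2 \<Rightarrow> 2 \<Rightarrow> 2 \<Rightarrow> 2 \<Rightarrow> real^2 \<Rightarrow> real" where
  "riemann g l k i j p = \<partial> i (christoffel g l j k) p - \<partial> j (christoffel g l i k) p +
     (\<Sum>m\<in>UNIV. christoffel g l i m p * christoffel g m j k p - christoffel g l j m p * christoffel g m i k p)"

definition gauss_curvature :: "(real^2 \<Rightarrow> real^2^2) \<Rightarrow> real^2 \<Rightarrow> real" where
  "gauss_curvature g p = (\<Sum>l\<in>UNIV. g p $ 1 $ l * riemann g l 2 1 2 p) / det (g p)"

text \<open>Convexity on a set that need not be convex: being the restriction of a convex function on
  the convex hull. For convex \<open>\<Omega>\<close> this is the library notion. Convexity along the segments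
  contained in \<open>\<Omega>\<close> would be strictly weaker and would not make the gradient map injective: it
  holds for every solution of the Hessian system, but for a slightly tilted catenoid over a slit
  annulus the gradient map of the solution is not injective.\<close>

definition convex_function :: "(real^2) set \<Rightarrow> (real^2 \<Rightarrow> real) \<Rightarrow> bool" where
  "convex_function \<Omega> f \<longleftrightarrow> (\<exists>F. convex_on (convex hull \<Omega>) F \<and> (\<forall>p\<in>\<Omega>. F p = f p))"

definition legendre_domain :: "(real^2) set \<Rightarrow> (real^2 \<Rightarrow> real) \<Rightarrow> (real^2) set" where
  "legendre_domain \<Omega> f = (\<lambda>p. vector [\<partial> 1 f p, \<partial> 2 f p]) ` \<Omega>"

end

theory Submission
  imports Defs
begin

text \<open>Write \<open>E = exp (varphi u)\<close> and let \<open>h\<close> be the second fundamental form paired with the chosen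
  unit normal. The Hessian system makes \<open>N'\<close> Lorentz orthogonal to \<open>\<psi>'\<close>, gives
  \<open>g' = (E / W)\<^sup>2 g\<close>, and differentiating the orthogonality relation gives
  \<open>h' = - (E / W) D\<^sup>2u\<close>, whereas \<open>h = D\<^sup>2u / W\<close>. Mean curvature, mean curvature vector and, by the
  Gauss equation for an ambient flat metric, the intrinsic curvature are all functions of \<open>(g, h)\<close>,
  so the two curvature relations and the equivalence of the minimal and maximal equations are
  algebra. The surface is a graph wherever \<open>\<nabla>\<phi>\<close> is injective, which follows from the positive
  definite Hessian on convex sets and from the subgradient inequality for convex functions.\<close>

section \<open>Smooth functions\<close>

text \<open>Let \<open>d\<close> be the gradient of \<open>u\<close> and \<open>c = E / W\<close>.
  The system says that the Hessian matrix of \<open>phi\<close> is \<open>c\<close> times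
  \<open>g = 1 + d d^T\<close>. Since \<open>|d|^2 = W^2 - 1\<close>, this Hessian maps
  \<open>d\<close> to \<open>c W^2 d = E W d\<close>, exactly the weight that cancels the height
  term \<open>W E d\<close> in the Lorentz product with \<open>N'\<close>. Likewise
  \<open>g^2 = g + W^2 d d^T\<close>, and the height term \<open>E^2 d d^T = c^2 W^2 d d^T\<close>
  removes the second summand, so that \<open>c^2 g\<close> remains. This is why the height must be a
  primitive of \<open>exp varphi\<close>: its gradient has to be \<open>E d\<close>. The obstacle is
  that normal parts, shape operators and Gauss curvature are defined by unique descriptions and
  Christoffel symbols, and are needed for a definite and for an indefinite ambient form. One locale
  treats both, with a sign \<open>\<epsilon>\<close> for the square of the unit normal.\<close>

lemma frechet_derivative_eqI: "(f has_derivative f') (at x) \<Longrightarrow> frechet_derivative f (at x) = f'"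
  by (metis frechet_derivative_at)

lemma frechet_derivative_plus:
  assumes "f differentiable at x" "g differentiable at x"
  shows "frechet_derivative (\<lambda>x. f x + g x) (at x) v = frechet_derivative f (at x) v + frechet_derivative g (at x) v"
  using frechet_derivative_eqI[OF has_derivative_add] assms[unfolded frechet_derivative_works] by metis

text \<open>Derivatives at a point depend on values nearby, so openness of \<open>S\<close> is what
  lets functions that agree only on \<open>S\<close> share them. The closure lemmas below use this
  to replace a derivative by its formula.\<close>

lemma Ck_on_cong:
  assumes "open S" "\<And>x. x \<in> S \<Longrightarrow> f x = g x" "Ck_on k S f"
  shows "Ck_on k S g"
  using assms(2,3)
proof (induction k arbitrary: f g)
  case 0
  then show ?case by (simp cong: continuous_on_cong)
next
  case (Suc k)
  have d: "g differentiable at x" "frechet_derivative g (at x) = frechet_derivative f (at x)" if "x \<in> S" for x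
  proof -
    have f: "(f has_derivative frechet_derivative f (at x)) (at x)"
      using Suc.prems(2) that frechet_derivative_works by auto
    then have "(g has_derivative frechet_derivative f (at x)) (at x)"
      using has_derivative_transform_within_open[OF f assms(1) that] Suc.prems(1) by auto
    then show "g differentiable at x" "frechet_derivative g (at x) = frechet_derivative f (at x)"
      by (auto simp: differentiable_def frechet_derivative_eqI)
  qed
  have "Ck_on k S (\<lambda>x. frechet_derivative g (at x) v)" for v
    by (rule Suc.IH[of "\<lambda>x. frechet_derivative f (at x) v"]) (use d Suc.prems in auto)
  then show ?case using d by simp
qed

lemma Ck_on_subset: "Ck_on k S f \<Longrightarrow> T \<subseteq> S \<Longrightarrow> Ck_on k T f"
  by (induction k arbitrary: f) (auto intro: continuous_on_subset)

text \<open>Product and chain rule leave one factor undifferentiated; its order has to be lowered by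
  one to meet the induction hypothesis.\<close>

lemma Ck_on_Suc_imp: "Ck_on (Suc k) S f \<Longrightarrow> Ck_on k S f"
proof (induction k arbitrary: f)
  case 0
  then show ?case
    by (auto intro!: continuous_at_imp_continuous_on differentiable_imp_continuous_within)
next
  case (Suc k)
  have "\<forall>x\<in>S. f differentiable at x" "\<And>v. Ck_on (Suc k) S (\<lambda>x. frechet_derivative f (at x) v)"
    using Suc.prems unfolding Ck_on.simps(2)[of "Suc k" S f] by blast+
  then show ?case using Suc.IH by auto
qed

lemma Ck_on_const: "open S \<Longrightarrow> Ck_on k S (\<lambda>_. c)"
  by (induction k arbitrary: c) (auto simp: frechet_derivative_const)

lemma Ck_on_add:
  assumes "open S" "Ck_on k S f" "Ck_on k S g"
  shows "Ck_on k S (\<lambda>x. f x + g x)"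
  using assms(2,3)
proof (induction k arbitrary: f g)
  case 0
  then show ?case by (auto intro: continuous_intros)
next
  case (Suc k)
  have "Ck_on k S (\<lambda>x. frechet_derivative (\<lambda>x. f x + g x) (at x) v)" for v
    by (rule Ck_on_cong[OF assms(1) _ Suc.IH[of "\<lambda>x. frechet_derivative f (at x) v" "\<lambda>x. frechet_derivative g (at x) v"]])
      (use Suc.prems in \<open>auto simp: frechet_derivative_plus\<close>)
  then show ?case using Suc.prems by auto
qed

lemma frechet_derivative_bilinear:
  assumes "bounded_bilinear b" "f differentiable at x" "g differentiable at x"
  shows "(\<lambda>x. b (f x) (g x)) differentiable at x"
    "frechet_derivative (\<lambda>x. b (f x) (g x)) (at x) v =
       b (f x) (frechet_derivative g (at x) v) + b (frechet_derivative f (at x) v) (g x)"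
proof -
  have "((\<lambda>x. b (f x) (g x)) has_derivative
      (\<lambda>v. b (f x) (frechet_derivative g (at x) v) + b (frechet_derivative f (at x) v) (g x))) (at x)"
    using bounded_bilinear.FDERIV[OF assms(1)] assms(2,3)[unfolded frechet_derivative_works] by fastforce
  then show "(\<lambda>x. b (f x) (g x)) differentiable at x"
    "frechet_derivative (\<lambda>x. b (f x) (g x)) (at x) v =
       b (f x) (frechet_derivative g (at x) v) + b (frechet_derivative f (at x) v) (g x)"
    by (auto simp: differentiable_def frechet_derivative_eqI)
qed

lemma frechet_derivative_linear:
  assumes "bounded_linear L" "f differentiable at x"
  shows "(\<lambda>x. L (f x)) differentiable at x"
    "frechet_derivative (\<lambda>x. L (f x)) (at x) v = L (frechet_derivative f (at x) v)"
proof -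
  have "((\<lambda>x. L (f x)) has_derivative (\<lambda>v. L (frechet_derivative f (at x) v))) (at x)"
    using bounded_linear.has_derivative[OF assms(1)] assms(2) frechet_derivative_works by blast
  then show "(\<lambda>x. L (f x)) differentiable at x"
    "frechet_derivative (\<lambda>x. L (f x)) (at x) v = L (frechet_derivative f (at x) v)"
    by (auto simp: differentiable_def frechet_derivative_eqI)
qed

lemma Ck_on_linear:
  assumes "open S" "bounded_linear L" "Ck_on k S f"
  shows "Ck_on k S (\<lambda>x. L (f x))"
  using assms(3)
proof (induction k arbitrary: f)
  case 0
  then show ?case by (auto intro: bounded_linear.continuous_on[OF assms(2)])
next
  case (Suc k)
  have "Ck_on k S (\<lambda>x. frechet_derivative (\<lambda>x. L (f x)) (at x) v)" for v
    by (rule Ck_on_cong[OF assms(1) _ Suc.IH[of "\<lambda>x. frechet_derivative f (at x) v"]])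
      (use Suc.prems in \<open>auto simp: frechet_derivative_linear[OF assms(2)]\<close>)
  moreover have "(\<lambda>x. L (f x)) differentiable at x" if "x \<in> S" for x
    by (rule frechet_derivative_linear(1)[OF assms(2)]) (use Suc.prems that in auto)
  ultimately show ?case by simp
qed

text \<open>The derivative is a sum of two expressions in the same \<open>b\<close>, so the
  induction closes with \<open>b\<close> fixed. Products, scalar multiples, inner products and the
  Lorentz form are all instances.\<close>

lemma Ck_on_bilinear:
  assumes "open S" "bounded_bilinear b" "Ck_on k S f" "Ck_on k S g"
  shows "Ck_on k S (\<lambda>x. b (f x) (g x))"
  using assms(3,4)
proof (induction k arbitrary: f g)
  case 0
  then show ?case by (auto intro: bounded_bilinear.continuous_on[OF assms(2)])
next
  case (Suc k)
  note c = Suc.prems[THEN Ck_on_Suc_imp]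
  have d: "f differentiable at x" "g differentiable at x" if "x \<in> S" for x
    using Suc.prems that by auto
  have "Ck_on k S (\<lambda>x. frechet_derivative (\<lambda>x. b (f x) (g x)) (at x) v)" for v
  proof (rule Ck_on_cong[OF assms(1)])
    show "Ck_on k S (\<lambda>x. b (f x) (frechet_derivative g (at x) v) + b (frechet_derivative f (at x) v) (g x))"
      by (intro Ck_on_add assms(1) Suc.IH c) (use Suc.prems in auto)
  qed (rule frechet_derivative_bilinear(2)[OF assms(2) d, symmetric])
  moreover have "(\<lambda>x. b (f x) (g x)) differentiable at x" if "x \<in> S" for x
    by (rule frechet_derivative_bilinear(1)[OF assms(2) d[OF that]])
  ultimately show ?case by simp
qed

lemma frechet_derivative_real_compose:
  fixes f :: "real \<Rightarrow> 'b::real_normed_vector"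
  assumes "g differentiable at x" "f differentiable at (g x)"
  shows "(\<lambda>x. f (g x)) differentiable at x"
    "frechet_derivative (\<lambda>x. f (g x)) (at x) v =
       frechet_derivative g (at x) v *\<^sub>R frechet_derivative f (at (g x)) 1"
proof -
  have f: "(f has_derivative frechet_derivative f (at (g x))) (at (g x))"
    using assms(2) frechet_derivative_works by blast
  have "((\<lambda>x. f (g x)) has_derivative (\<lambda>v. frechet_derivative f (at (g x)) (frechet_derivative g (at x) v))) (at x)"
    using diff_chain_at[OF assms(1)[unfolded frechet_derivative_works] f] by (simp add: o_def)
  moreover have "frechet_derivative f (at (g x)) (frechet_derivative g (at x) v) =
       frechet_derivative g (at x) v *\<^sub>R frechet_derivative f (at (g x)) 1"
    using linear_scale[OF has_derivative_linear[OF f], of "frechet_derivative g (at x) v" 1] by simp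
  ultimately show "(\<lambda>x. f (g x)) differentiable at x"
    "frechet_derivative (\<lambda>x. f (g x)) (at x) v =
       frechet_derivative g (at x) v *\<^sub>R frechet_derivative f (at (g x)) 1"
    by (auto simp: differentiable_def frechet_derivative_eqI)
qed

text \<open>For an outer function of one real variable, the chain rule is a scalar multiple of
  \<open>f'\<close> composed with \<open>g\<close>. The induction can therefore vary
  \<open>f\<close> and keep \<open>g\<close>.\<close>

lemma Ck_on_real_compose:
  fixes f :: "real \<Rightarrow> 'b::real_normed_vector"
  assumes "open S" "Ck_on k I f" "Ck_on k S g" "g ` S \<subseteq> I"
  shows "Ck_on k S (\<lambda>x. f (g x))"
  using assms(2-)
proof (induction k arbitrary: f)
  case 0
  then show ?case by (auto intro: continuous_on_compose2)
next
  case (Suc k)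
  note c = Suc.prems(2)[THEN Ck_on_Suc_imp]
  have d: "g differentiable at x" "f differentiable at (g x)" if "x \<in> S" for x
    using Suc.prems that by auto
  have "Ck_on k S (\<lambda>x. frechet_derivative (\<lambda>x. f (g x)) (at x) v)" for v
  proof (rule Ck_on_cong[OF assms(1)])
    show "Ck_on k S (\<lambda>x. frechet_derivative g (at x) v *\<^sub>R frechet_derivative f (at (g x)) 1)"
      by (intro Ck_on_bilinear[OF assms(1) bounded_bilinear_scaleR] Suc.IH[of "\<lambda>y. frechet_derivative f (at y) 1"] c)
        (use Suc.prems in auto)
  qed (rule frechet_derivative_real_compose(2)[OF d, symmetric])
  moreover have "(\<lambda>x. f (g x)) differentiable at x" if "x \<in> S" for x
    by (rule frechet_derivative_real_compose(1)[OF d[OF that]])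
  ultimately show ?case by simp
qed

lemma smooth_on_cong: "open S \<Longrightarrow> (\<And>x. x \<in> S \<Longrightarrow> f x = g x) \<Longrightarrow> smooth_on S f \<Longrightarrow> smooth_on S g"
  unfolding smooth_on_def using Ck_on_cong by blast

lemma smooth_on_subset: "smooth_on S f \<Longrightarrow> T \<subseteq> S \<Longrightarrow> smooth_on T f"
  unfolding smooth_on_def using Ck_on_subset by blast

lemma smooth_on_const: "open S \<Longrightarrow> smooth_on S (\<lambda>_. c)"
  unfolding smooth_on_def using Ck_on_const by blast

lemma smooth_on_add: "open S \<Longrightarrow> smooth_on S f \<Longrightarrow> smooth_on S g \<Longrightarrow> smooth_on S (\<lambda>x. f x + g x)"
  unfolding smooth_on_def using Ck_on_add by blast

lemma smooth_on_linear: "open S \<Longrightarrow> bounded_linear L \<Longrightarrow> smooth_on S f \<Longrightarrow> smooth_on S (\<lambda>x. L (f x))"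
  unfolding smooth_on_def using Ck_on_linear by blast

lemma smooth_on_bilinear:
  "open S \<Longrightarrow> bounded_bilinear b \<Longrightarrow> smooth_on S f \<Longrightarrow> smooth_on S g \<Longrightarrow> smooth_on S (\<lambda>x. b (f x) (g x))"
  unfolding smooth_on_def using Ck_on_bilinear by blast

lemmas smooth_on_scaleR = smooth_on_bilinear[OF _ bounded_bilinear_scaleR]

lemma smooth_on_mult:
  fixes f :: "_ \<Rightarrow> real"
  shows "open S \<Longrightarrow> smooth_on S f \<Longrightarrow> smooth_on S g \<Longrightarrow> smooth_on S (\<lambda>x. f x * g x)"
  by (rule smooth_on_bilinear[OF _ bounded_bilinear_mult])

lemma smooth_on_uminus: "open S \<Longrightarrow> smooth_on S f \<Longrightarrow> smooth_on S (\<lambda>x. - f x)"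
  by (rule smooth_on_linear[OF _ bounded_linear_minus[OF bounded_linear_ident]])

lemma smooth_on_real_compose:
  fixes f :: "real \<Rightarrow> 'b::real_normed_vector"
  shows "open S \<Longrightarrow> smooth_on I f \<Longrightarrow> smooth_on S g \<Longrightarrow> g ` S \<subseteq> I \<Longrightarrow> smooth_on S (\<lambda>x. f (g x))"
  unfolding smooth_on_def using Ck_on_real_compose by blast

lemma smooth_on_differentiable: "smooth_on S f \<Longrightarrow> x \<in> S \<Longrightarrow> f differentiable at x"
  unfolding smooth_on_def by (metis Ck_on.simps(2))

lemma smooth_on_frechet: "smooth_on S f \<Longrightarrow> smooth_on S (\<lambda>x. frechet_derivative f (at x) v)"
  unfolding smooth_on_def by (metis Ck_on.simps(2))

text \<open>Suits functions known through their derivatives, such as a primitive or a solution of a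
  differential system.\<close>

lemma smooth_onI:
  assumes "\<And>x. x \<in> S \<Longrightarrow> f differentiable at x"
    "\<And>v. smooth_on S (\<lambda>x. frechet_derivative f (at x) v)"
  shows "smooth_on S f"
proof -
  have "Ck_on (Suc k) S f" for k using assms by (auto simp: smooth_on_def)
  then show ?thesis unfolding smooth_on_def using Ck_on_Suc_imp by blast
qed

text \<open>If the directional derivatives of every \<open>k \<circ> g\<close> are again of the form \<open>k' \<circ> g\<close> with \<open>k'\<close>
  smooth, the whole class consists of smooth functions; for an inverse \<open>g\<close> this bootstraps the
  derivative formula of the inverse to full smoothness.\<close>

lemma smooth_on_bootstrap:
  fixes g :: "'a::real_normed_vector \<Rightarrow> 'b::real_normed_vector" and k :: "'b \<Rightarrow> real"
  assumes "open D"
    and step: "\<And>k :: 'b \<Rightarrow> real. smooth_on S k \<Longrightarrow> (\<forall>y\<in>D. (\<lambda>y. k (g y)) differentiable at y) \<and>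
       (\<forall>v. \<exists>k'. smooth_on S k' \<and> (\<forall>y\<in>D. frechet_derivative (\<lambda>y. k (g y)) (at y) v = k' (g y)))"
    and "smooth_on S k"
  shows "smooth_on D (\<lambda>y. k (g y))"
  unfolding smooth_on_def
proof
  fix n show "Ck_on n D (\<lambda>y. k (g y))"
    using assms(3)
  proof (induction n arbitrary: k)
    case 0
    then show ?case using step
      by (auto intro!: continuous_at_imp_continuous_on differentiable_imp_continuous_within)
  next
    case (Suc n)
    have "Ck_on n D (\<lambda>y. frechet_derivative (\<lambda>y. k (g y)) (at y) v)" for v
    proof -
      obtain k' where k': "smooth_on S k'" "\<forall>y\<in>D. frechet_derivative (\<lambda>y. k (g y)) (at y) v = k' (g y)"
        using step[OF Suc.prems] by blast
      show ?thesis by (rule Ck_on_cong[OF assms(1) _ Suc.IH[OF k'(1)]]) (simp add: k'(2))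
    qed
    then show ?case using step[OF Suc.prems] by auto
  qed
qed

text \<open>The exponent stays free because each derivative lowers it by one. The exponents
  \<open>-1\<close> and \<open>1 / 2\<close> supply reciprocals and the root in
  \<open>W\<close>.\<close>

lemma smooth_on_powr: "smooth_on {0<..} (\<lambda>x::real. x powr a)"
  unfolding smooth_on_def
proof
  fix k show "Ck_on k {0<..} (\<lambda>x::real. x powr a)"
  proof (induction k arbitrary: a)
    case 0
    then show ?case by (auto intro!: continuous_intros)
  next
    case (Suc k)
    have d: "((\<lambda>x. x powr a) has_derivative (*) (a * x powr (a - 1))) (at x)" if "x > 0" for x :: real
      using has_real_derivative_powr[OF that] by (simp add: has_field_derivative_def)
    have "Ck_on k {0<..} (\<lambda>x::real. frechet_derivative (\<lambda>x. x powr a) (at x) v)" for v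
      by (rule Ck_on_cong[OF _ _ Ck_on_linear[OF _ bounded_linear_mult_right[of "v * a"] Suc.IH[of "a - 1"]]])
        (auto simp: frechet_derivative_at[OF d, symmetric])
    then show ?case using d by (auto simp: differentiable_def)
  qed
qed

lemma smooth_on_exp: "smooth_on UNIV (\<lambda>x::real. exp x)"
  unfolding smooth_on_def
proof
  fix k show "Ck_on k UNIV (\<lambda>x::real. exp x)"
  proof (induction k)
    case 0
    then show ?case by (auto intro!: continuous_intros)
  next
    case (Suc k)
    have d: "(exp has_derivative (*) (exp x)) (at x)" for x :: real
      using DERIV_exp[of x] by (simp add: has_field_derivative_def)
    have "Ck_on k UNIV (\<lambda>x::real. frechet_derivative exp (at x) v)" for v
      by (rule Ck_on_cong[OF _ _ Ck_on_linear[OF _ bounded_linear_mult_right[of v] Suc.IH]])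
        (auto simp: frechet_derivative_at[OF d, symmetric])
    then show ?case using d by (auto simp: differentiable_def)
  qed
qed

lemma partial_eq_frechet:
  fixes f :: "real^2 \<Rightarrow> 'b::real_normed_vector"
  assumes "f differentiable at p"
  shows "frechet_derivative f (at p) v = v$1 *\<^sub>R \<partial> 1 f p + v$2 *\<^sub>R \<partial> 2 f p"
proof -
  have l: "linear (frechet_derivative f (at p))"
    using assms by (rule linear_frechet_derivative)
  have "v = v$1 *\<^sub>R axis 1 1 + v$2 *\<^sub>R axis 2 1"
    by (simp add: vec_eq_iff forall_2 axis_def)
  then have "frechet_derivative f (at p) v = frechet_derivative f (at p) (v$1 *\<^sub>R axis 1 1 + v$2 *\<^sub>R axis 2 1)"
    by simp
  also have "\<dots> = v$1 *\<^sub>R \<partial> 1 f p + v$2 *\<^sub>R \<partial> 2 f p"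
    by (simp add: linear_add[OF l] linear_scale[OF l] partial_deriv_def)
  finally show ?thesis .
qed

lemma smooth_on_partial: "smooth_on S f \<Longrightarrow> smooth_on S (\<partial> i f)"
  unfolding partial_deriv_def[abs_def] by (rule smooth_on_frechet)

lemma smooth_onI_partial:
  assumes "open S" "\<And>x. x \<in> S \<Longrightarrow> f differentiable at x" "smooth_on S (\<partial> 1 f)" "smooth_on S (\<partial> 2 f)"
  shows "smooth_on S f"
proof (rule smooth_onI)
  fix v
  show "smooth_on S (\<lambda>x. frechet_derivative f (at x) v)"
    by (rule smooth_on_cong[OF assms(1), of "\<lambda>p. v$1 *\<^sub>R \<partial> 1 f p + v$2 *\<^sub>R \<partial> 2 f p"])
      (auto simp: partial_eq_frechet assms intro!: smooth_on_add smooth_on_scaleR smooth_on_const)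
qed (use assms in auto)

lemma partial_cong:
  assumes "open S" "p \<in> S" "\<And>x. x \<in> S \<Longrightarrow> f x = g x"
  shows "\<partial> i f p = \<partial> i g p"
proof -
  have "(f has_derivative L) (at p) \<longleftrightarrow> (g has_derivative L) (at p)" for L
    using has_derivative_transform_within_open[OF _ assms(1,2)] assms(3) by metis
  then show ?thesis unfolding partial_deriv_def frechet_derivative_def by simp
qed

section \<open>Symmetry of second derivatives\<close>

lemma second_difference:
  fixes f :: "'a::real_normed_vector \<Rightarrow> real"
  assumes C2: "Ck_on 2 S f"
    and box: "\<And>s t. 0 \<le> s \<Longrightarrow> s \<le> h \<Longrightarrow> 0 \<le> t \<Longrightarrow> t \<le> h \<Longrightarrow> p + s *\<^sub>R v + t *\<^sub>R w \<in> S"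
    and "0 < h"
  shows "\<exists>s t. 0 < s \<and> s < h \<and> 0 < t \<and> t < h \<and>
    f (p + h *\<^sub>R v + h *\<^sub>R w) - f (p + h *\<^sub>R v) - f (p + h *\<^sub>R w) + f p =
    h\<^sup>2 * frechet_derivative (\<lambda>x. frechet_derivative f (at x) v) (at (p + s *\<^sub>R v + t *\<^sub>R w)) w"
proof -
  define f1 where "f1 = (\<lambda>x. frechet_derivative f (at x) v)"
  have df: "f differentiable at x" and df1: "f1 differentiable at x" if "x \<in> S" for x
    using C2 that by (auto simp: numeral_2_eq_2 f1_def)
  have D: "((\<lambda>s. F (a + s *\<^sub>R d)) has_real_derivative frechet_derivative F (at (a + s *\<^sub>R d)) d) (at s)"
    if "F differentiable at (a + s *\<^sub>R d)" for F :: "'a \<Rightarrow> real" and a d and s :: real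
  proof -
    have F: "(F has_derivative frechet_derivative F (at (a + s *\<^sub>R d))) (at (a + s *\<^sub>R d))"
      using that frechet_derivative_works by blast
    have "((\<lambda>s. a + s *\<^sub>R d) has_derivative (\<lambda>h. h *\<^sub>R d)) (at s)"
      by (auto intro!: derivative_eq_intros)
    from diff_chain_at[OF this F]
    show ?thesis
      unfolding o_def by (rule has_derivative_imp_has_field_derivative)
        (simp add: linear_scale[OF has_derivative_linear[OF F]])
  qed
  \<comment> \<open>\<open>g\<close> is the increment of \<open>f\<close> across direction
    \<open>w\<close>, so \<open>g h - g 0\<close> is the second difference over the parallelogram.
    One mean value step along \<open>v\<close> and one along \<open>w\<close> turn it into a mixed
    derivative at an interior point.\<close>
  define g where "g = (\<lambda>s. f ((p + h *\<^sub>R w) + s *\<^sub>R v) - f (p + s *\<^sub>R v))"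
  have "(g has_real_derivative f1 ((p + h *\<^sub>R w) + s *\<^sub>R v) - f1 (p + s *\<^sub>R v)) (at s)" if "0 \<le> s" "s \<le> h" for s
    unfolding g_def f1_def
    by (intro DERIV_diff D df) (use that \<open>0 < h\<close> box[of s h] box[of s 0] in \<open>auto simp: algebra_simps\<close>)
  from MVT2[OF \<open>0 < h\<close>, of g, OF this]
  obtain s where s: "0 < s" "s < h" "g h - g 0 = h * (f1 ((p + h *\<^sub>R w) + s *\<^sub>R v) - f1 (p + s *\<^sub>R v))"
    by auto
  have "((\<lambda>t. f1 ((p + s *\<^sub>R v) + t *\<^sub>R w)) has_real_derivative frechet_derivative f1 (at ((p + s *\<^sub>R v) + t *\<^sub>R w)) w) (at t)"
    if "0 \<le> t" "t \<le> h" for t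
    by (intro D df1) (use that s box[of s t] in auto)
  from MVT2[OF \<open>0 < h\<close>, OF this]
  obtain t where t: "0 < t" "t < h"
    "f1 ((p + s *\<^sub>R v) + h *\<^sub>R w) - f1 (p + s *\<^sub>R v) = h * frechet_derivative f1 (at ((p + s *\<^sub>R v) + t *\<^sub>R w)) w"
    by auto
  have "g h - g 0 = h\<^sup>2 * frechet_derivative f1 (at (p + s *\<^sub>R v + t *\<^sub>R w)) w"
    using s(3) t(3) by (simp add: algebra_simps power2_eq_square)
  then show ?thesis using s t unfolding f1_def g_def
    by (intro exI[of _ s] exI[of _ t]) (simp add: algebra_simps)
qed

text \<open>The second difference is symmetric in \<open>v\<close> and \<open>w\<close>, but the two
  orders of mean value steps express it by the two mixed derivatives at nearby points. Shrinking the
  parallelogram and continuity identify their values at \<open>p\<close>.\<close>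

lemma symmetric_second_derivative_real:
  fixes f :: "'a::real_normed_vector \<Rightarrow> real"
  assumes "open S" "p \<in> S" "Ck_on 2 S f"
  shows "frechet_derivative (\<lambda>x. frechet_derivative f (at x) v) (at p) w =
         frechet_derivative (\<lambda>x. frechet_derivative f (at x) w) (at p) v"
proof -
  define A where "A = (\<lambda>v w x. frechet_derivative (\<lambda>x. frechet_derivative f (at x) v) (at x) w)"
  have cont: "continuous_on S (A v w)" for v w
    using assms(3) by (simp add: numeral_2_eq_2 A_def)
  have "\<bar>A v w p - A w v p\<bar> \<le> e" if "e > 0" for e
  proof -
    have "isCont (A v w) p" "isCont (A w v) p"
      using cont assms(1,2) continuous_on_eq_continuous_at by blast+
    then have "\<forall>\<^sub>F x in nhds p. x \<in> S \<and> dist (A v w x) (A v w p) < e/2 \<and> dist (A w v x) (A w v p) < e/2"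
      using assms(1,2) that unfolding isCont_def tendsto_at_iff_tendsto_nhds
      by (auto intro!: eventually_conj eventually_nhds_in_open dest: tendstoD[where e="e/2"])
    then obtain d where d: "d > 0"
      "\<And>x. dist x p < d \<Longrightarrow> x \<in> S \<and> dist (A v w x) (A v w p) < e/2 \<and> dist (A w v x) (A w v p) < e/2"
      unfolding eventually_nhds_metric by blast
    \<comment> \<open>With this side length the whole parallelogram lies within \<open>d\<close> of
      \<open>p\<close>; the summand 1 keeps the quotient meaningful when both directions
      vanish.\<close>
    define h where "h = d / (norm v + norm w + 1) / 2"
    have n: "norm v + norm w + 1 > 0" by (smt (verit) norm_ge_zero)
    have h: "h > 0" using d n by (simp add: h_def)
    have near: "dist (p + s *\<^sub>R v + t *\<^sub>R w) p < d" "dist (p + s *\<^sub>R w + t *\<^sub>R v) p < d"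
      if "0 \<le> s" "s \<le> h" "0 \<le> t" "t \<le> h" for s t
    proof -
      have nb: "s * norm a + t * norm b < d" if "norm a + norm b = norm v + norm w" for a b :: 'a
      proof -
        have "s * norm a + t * norm b \<le> h * norm a + h * norm b"
          using \<open>s \<le> h\<close> \<open>t \<le> h\<close> by (intro add_mono mult_right_mono) auto
        also have "\<dots> = h * (norm v + norm w)" using that by (simp flip: distrib_left)
        also have "\<dots> < h * (2 * (norm v + norm w + 1))" using h n by (intro mult_strict_left_mono) auto
        also have "\<dots> = d"
        proof -
          have "d / m / 2 * (2 * m) = d" if "m > 0" for m :: real using that by simp
          from this[OF n] show ?thesis unfolding h_def .
        qed
        finally show ?thesis .
      qed
      have "norm (s *\<^sub>R a + t *\<^sub>R b) \<le> s * norm a + t * norm b" for a b :: 'a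
        using norm_triangle_ineq[of "s *\<^sub>R a" "t *\<^sub>R b"] that by simp
      then show "dist (p + s *\<^sub>R v + t *\<^sub>R w) p < d" "dist (p + s *\<^sub>R w + t *\<^sub>R v) p < d"
        using nb[of v w] nb[of w v] by (auto simp: dist_norm add.assoc intro: le_less_trans)
    qed
    obtain s t where st: "0 < s" "s < h" "0 < t" "t < h"
      "f (p + h *\<^sub>R v + h *\<^sub>R w) - f (p + h *\<^sub>R v) - f (p + h *\<^sub>R w) + f p = h\<^sup>2 * A v w (p + s *\<^sub>R v + t *\<^sub>R w)"
      using second_difference[OF assms(3) _ h, of p v w] near d unfolding A_def by metis
    obtain s' t' where st': "0 < s'" "s' < h" "0 < t'" "t' < h"
      "f (p + h *\<^sub>R w + h *\<^sub>R v) - f (p + h *\<^sub>R w) - f (p + h *\<^sub>R v) + f p = h\<^sup>2 * A w v (p + s' *\<^sub>R w + t' *\<^sub>R v)"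
      using second_difference[OF assms(3) _ h, of p w v] near d unfolding A_def by metis
    have "h\<^sup>2 * A v w (p + s *\<^sub>R v + t *\<^sub>R w) = h\<^sup>2 * A w v (p + s' *\<^sub>R w + t' *\<^sub>R v)"
      unfolding st(5)[symmetric] st'(5)[symmetric] by (simp add: algebra_simps)
    then have eq: "A v w (p + s *\<^sub>R v + t *\<^sub>R w) = A w v (p + s' *\<^sub>R w + t' *\<^sub>R v)" using h by simp
    have "dist (A v w (p + s *\<^sub>R v + t *\<^sub>R w)) (A v w p) < e/2"
      "dist (A w v (p + s' *\<^sub>R w + t' *\<^sub>R v)) (A w v p) < e/2"
      using d(2) near st st' by (auto simp: less_imp_le)
    then show ?thesis using eq unfolding dist_real_def by linarith
  qed
  then have "\<bar>A v w p - A w v p\<bar> \<le> 0" by (rule field_le_epsilon) simp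
  then show ?thesis by (simp add: A_def)
qed

text \<open>Pairing \<open>f\<close> with the constant vector \<open>d\<close>, the difference of
  the two sides, reduces to the real case and gives \<open>d \<bullet> d = 0\<close>.\<close>

lemma symmetric_second_derivative:
  fixes f :: "'a::real_normed_vector \<Rightarrow> 'b::real_inner"
  assumes "open S" "p \<in> S" "Ck_on 2 S f"
  shows "frechet_derivative (\<lambda>x. frechet_derivative f (at x) v) (at p) w =
         frechet_derivative (\<lambda>x. frechet_derivative f (at x) w) (at p) v" (is "?l = ?r")
proof -
  define d where "d = ?l - ?r"
  have L: "bounded_linear (\<lambda>x. d \<bullet> x)" by (rule bounded_linear_inner_right)
  have *: "frechet_derivative (\<lambda>x. frechet_derivative (\<lambda>y. d \<bullet> f y) (at x) v) (at p) w =
      d \<bullet> frechet_derivative (\<lambda>x. frechet_derivative f (at x) v) (at p) w" for v w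
  proof -
    have f: "(\<lambda>x. frechet_derivative f (at x) v) differentiable at p"
      using assms(2,3) by (auto simp: numeral_2_eq_2)
    have "frechet_derivative (\<lambda>x. frechet_derivative (\<lambda>y. d \<bullet> f y) (at x) v) (at p) =
        frechet_derivative (\<lambda>x. d \<bullet> frechet_derivative f (at x) v) (at p)"
    proof (rule sym, rule frechet_derivative_transform_within_open[OF _ assms(1,2)])
      show "(\<lambda>x. d \<bullet> frechet_derivative f (at x) v) differentiable at p"
        using frechet_derivative_linear(1)[OF L f] .
      show "\<And>x. x \<in> S \<Longrightarrow> d \<bullet> frechet_derivative f (at x) v = frechet_derivative (\<lambda>y. d \<bullet> f y) (at x) v"
        by (rule frechet_derivative_linear(2)[OF L, symmetric]) (use assms(3) in \<open>auto simp: numeral_2_eq_2\<close>)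
    qed
    then show ?thesis using frechet_derivative_linear(2)[OF L f] by simp
  qed
  have "Ck_on 2 S (\<lambda>x. d \<bullet> f x)" by (rule Ck_on_linear[OF assms(1) L assms(3)])
  from symmetric_second_derivative_real[OF assms(1,2) this, of v w]
  have "d \<bullet> ?l = d \<bullet> ?r" unfolding * .
  then have "d \<bullet> d = 0" by (simp add: d_def inner_diff_right)
  then show ?thesis by (simp add: d_def)
qed

lemma partial_commute:
  fixes f :: "real^2 \<Rightarrow> 'b::real_inner"
  assumes "open S" "p \<in> S" "Ck_on 2 S f"
  shows "\<partial> i (\<partial> j f) p = \<partial> j (\<partial> i f) p"
  using symmetric_second_derivative[OF assms] by (simp add: partial_deriv_def[abs_def])

section \<open>Inverses and positivity of two by two matrices\<close>

lemma matrix_inv_unique: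
  fixes A :: "real^'n^'n"
  assumes "A ** C = mat 1" "C ** A = mat 1"
  shows "matrix_inv A = C"
proof -
  have "A ** matrix_inv A = mat 1 \<and> matrix_inv A ** A = mat 1"
    unfolding matrix_inv_def by (rule someI[of _ C]) (use assms in simp)
  then show ?thesis using assms by (metis matrix_mul_assoc matrix_mul_lid matrix_mul_rid)
qed

lemma matrix_inv_2:
  fixes A :: "real^2^2"
  assumes "det A \<noteq> 0"
  shows "matrix_inv A $ 1 $ 1 = A$2$2 / det A" "matrix_inv A $ 1 $ 2 = - A$1$2 / det A"
    "matrix_inv A $ 2 $ 1 = - A$2$1 / det A" "matrix_inv A $ 2 $ 2 = A$1$1 / det A"
proof -
  define C :: "real^2^2" where
    "C = vector [vector [A$2$2 / det A, - A$1$2 / det A], vector [- A$2$1 / det A, A$1$1 / det A]]"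
  have "matrix_inv A = C"
    by (rule matrix_inv_unique)
      (use assms in \<open>simp_all add: C_def vec_eq_iff forall_2 matrix_matrix_mult_def sum_2 mat_def divide_simps,
        simp_all add: det_2 algebra_simps\<close>)
  then show "matrix_inv A $ 1 $ 1 = A$2$2 / det A" "matrix_inv A $ 1 $ 2 = - A$1$2 / det A"
    "matrix_inv A $ 2 $ 1 = - A$2$1 / det A" "matrix_inv A $ 2 $ 2 = A$1$1 / det A"
    by (simp_all add: C_def)
qed

lemma positive_definite_iff:
  assumes "G$1$2 = G$2$1"
  shows "positive_definite G \<longleftrightarrow> G$1$1 > 0 \<and> det G > 0"
proof
  have q: "v \<bullet> (G *v v) = G$1$1 * (v$1)\<^sup>2 + 2 * G$1$2 * v$1 * v$2 + G$2$2 * (v$2)\<^sup>2" for v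
    using assms by (simp add: inner_vec_def matrix_vector_mult_def sum_2 algebra_simps power2_eq_square)
  {
    assume *: "positive_definite G"
    have "(vector [1, 0] :: real^2) \<noteq> 0" by (simp add: vec_eq_iff forall_2)
    with * have "vector [1, 0] \<bullet> (G *v vector [1, 0]) > 0" unfolding positive_definite_def by blast
    then have g: "G$1$1 > 0" unfolding q by simp
    \<comment> \<open>This vector is orthogonal, with respect to the form, to the first coordinate
      vector; the form takes the value \<open>G$1$1 * det G\<close> on it.\<close>
    then have "(vector [- G$1$2, G$1$1] :: real^2) \<noteq> 0" by (simp add: vec_eq_iff forall_2)
    with * have "vector [- G$1$2, G$1$1] \<bullet> (G *v vector [- G$1$2, G$1$1]) > 0"
      unfolding positive_definite_def by blast
    then have "G$1$1 * det G > 0"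
      unfolding q using assms by (simp add: det_2 algebra_simps power2_eq_square)
    with g show "G$1$1 > 0 \<and> det G > 0" by (simp add: zero_less_mult_iff)
  }
  assume *: "G$1$1 > 0 \<and> det G > 0"
  show "positive_definite G"
    unfolding positive_definite_def
  proof (intro allI impI)
    fix v :: "real^2" assume "v \<noteq> 0"
    \<comment> \<open>Completing the square in \<open>v$1\<close>.\<close>
    have e: "G$1$1 * (v \<bullet> (G *v v)) = (G$1$1 * v$1 + G$1$2 * v$2)\<^sup>2 + det G * (v$2)\<^sup>2"
      unfolding q using assms by (simp add: det_2 algebra_simps power2_eq_square)
    have "\<dots> > 0"
    proof (cases "v$2 = 0")
      case True
      then have "v$1 \<noteq> 0" using \<open>v \<noteq> 0\<close> by (auto simp: vec_eq_iff forall_2)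
      then show ?thesis using True * by simp
    next
      case False
      then show ?thesis using * by (intro add_nonneg_pos) auto
    qed
    with e * show "v \<bullet> (G *v v) > 0" by (metis zero_less_mult_pos)
  qed
qed

lemma smooth_on_inverse:
  fixes f :: "_ \<Rightarrow> real"
  assumes "open S" "smooth_on S f" "\<And>x. x \<in> S \<Longrightarrow> f x > 0"
  shows "smooth_on S (\<lambda>x. 1 / f x)"
proof (rule smooth_on_cong[OF assms(1)])
  show "smooth_on S (\<lambda>x. f x powr (-1))"
    by (rule smooth_on_real_compose[OF assms(1) smooth_on_powr assms(2)]) (use assms(3) in auto)
qed (simp add: powr_minus_divide assms(3) less_imp_le)

lemma partial_bilinear:
  assumes "bounded_bilinear b" "f differentiable at p" "g differentiable at p"
  shows "\<partial> i (\<lambda>x. b (f x) (g x)) p = b (f p) (\<partial> i g p) + b (\<partial> i f p) (g p)"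
  unfolding partial_deriv_def by (rule frechet_derivative_bilinear(2)[OF assms])

lemma smooth_on_partial_commute:
  fixes f :: "real^2 \<Rightarrow> 'b::real_inner"
  shows "open S \<Longrightarrow> p \<in> S \<Longrightarrow> smooth_on S f \<Longrightarrow> \<partial> i (\<partial> j f) p = \<partial> j (\<partial> i f) p"
  unfolding smooth_on_def by (blast intro: partial_commute)

section \<open>Surfaces with a unit normal in a flat ambient space\<close>

text \<open>\<open>B\<close> itself may be indefinite; only the metric it induces on the surface is
  positive. The condition on \<open>\<epsilon>\<close> says that it is 1 or -1 in the form used
  later: \<open>\<epsilon>\<close> is its own inverse.\<close>

locale surface_with_normal =
  fixes B :: "real^3 \<Rightarrow> real^3 \<Rightarrow> real" and \<epsilon> :: real and \<Omega> :: "(real^2) set" and \<psi> N :: "real^2 \<Rightarrow> real^3"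
  assumes open_domain: "open \<Omega>"
    and bilinear: "bounded_bilinear B"
    and commute: "\<And>v w. B v w = B w v"
    and nondegenerate: "\<And>w. (\<And>z. B w z = 0) \<Longrightarrow> w = 0"
    and smooth: "smooth_on \<Omega> \<psi>"
    and positive: "\<And>p. p \<in> \<Omega> \<Longrightarrow> positive_definite (induced_metric B \<psi> p)"
    and normal: "\<And>p i. p \<in> \<Omega> \<Longrightarrow> B (N p) (\<partial> i \<psi> p) = 0"
    and unit: "\<And>p. p \<in> \<Omega> \<Longrightarrow> B (N p) (N p) = \<epsilon>"
    and sign: "\<epsilon> * \<epsilon> = 1"
    and N_differentiable: "\<And>p. p \<in> \<Omega> \<Longrightarrow> N differentiable at p"
begin

abbreviation g where "g \<equiv> induced_metric B \<psi>"

text \<open>Scalar version of the second fundamental form: the vector valued one is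
  \<open>\<epsilon> * h p $ i $ j\<close> times \<open>N p\<close>.\<close>

definition h :: "real^2 \<Rightarrow> real^2^2" where
  "h p = (\<chi> i j. B (\<partial> i (\<partial> j \<psi>) p) (N p))"

definition H :: "real^2 \<Rightarrow> real" where
  "H p = (\<Sum>i\<in>UNIV. \<Sum>j\<in>UNIV. matrix_inv (g p) $ i $ j * h p $ i $ j)"

lemmas B_simps =
  bounded_bilinear.add_left[OF bilinear] bounded_bilinear.add_right[OF bilinear]
  bounded_bilinear.diff_left[OF bilinear] bounded_bilinear.diff_right[OF bilinear]
  bounded_bilinear.minus_left[OF bilinear] bounded_bilinear.minus_right[OF bilinear]
  bounded_bilinear.scaleR_left[OF bilinear] bounded_bilinear.scaleR_right[OF bilinear]
  bounded_bilinear.zero_left[OF bilinear] bounded_bilinear.zero_right[OF bilinear]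

lemma g_component: "g p $ i $ j = B (\<partial> i \<psi> p) (\<partial> j \<psi> p)"
  by (simp add: induced_metric_def)

lemma g_sym: "g p $ i $ j = g p $ j $ i"
  by (simp add: g_component commute)

lemma g_positive: "p \<in> \<Omega> \<Longrightarrow> g p $ 1 $ 1 > 0 \<and> det (g p) > 0"
  using positive positive_definite_iff[OF g_sym] by blast

lemma normal': "p \<in> \<Omega> \<Longrightarrow> B (\<partial> i \<psi> p) (N p) = 0"
  using normal commute by metis

lemma frechet: "p \<in> \<Omega> \<Longrightarrow> frechet_derivative \<psi> (at p) v = v$1 *\<^sub>R \<partial> 1 \<psi> p + v$2 *\<^sub>R \<partial> 2 \<psi> p"
  by (rule partial_eq_frechet[OF smooth_on_differentiable[OF smooth]])

text \<open>The quadratic form of \<open>g p\<close> at \<open>v\<close> is the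
  \<open>B\<close>-square of this tangent vector, so positivity of the induced metric gives
  injectivity of the differential even for indefinite \<open>B\<close>.\<close>

lemma frechet_eq_0:
  fixes v :: "real^2"
  assumes "p \<in> \<Omega>" "v$1 *\<^sub>R \<partial> 1 \<psi> p + v$2 *\<^sub>R \<partial> 2 \<psi> p = 0"
  shows "v = 0"
proof (rule ccontr)
  assume "v \<noteq> 0"
  then have "v \<bullet> (g p *v v) > 0" using positive[OF assms(1)] unfolding positive_definite_def by blast
  moreover have "v \<bullet> (g p *v v) = B (v$1 *\<^sub>R \<partial> 1 \<psi> p + v$2 *\<^sub>R \<partial> 2 \<psi> p) (v$1 *\<^sub>R \<partial> 1 \<psi> p + v$2 *\<^sub>R \<partial> 2 \<psi> p)"
    by (simp add: inner_vec_def matrix_vector_mult_def sum_2 g_component B_simps algebra_simps)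
  ultimately show False using assms(2) by (simp add: B_simps)
qed

text \<open>The tangent vectors and \<open>N p\<close> form a basis: pairing a vanishing combination
  with \<open>N p\<close> kills the normal coefficient, and injectivity of the differential kills
  the others. Nondegeneracy of \<open>B\<close> then applies.\<close>

lemma orthogonal_eq_0:
  assumes p: "p \<in> \<Omega>" and "\<And>i. B w (\<partial> i \<psi> p) = 0" "B w (N p) = 0"
  shows "w = 0"
proof (rule nondegenerate)
  fix z
  define T :: "real^3 \<Rightarrow> real^3" where "T = (\<lambda>c. c$1 *\<^sub>R \<partial> 1 \<psi> p + c$2 *\<^sub>R \<partial> 2 \<psi> p + c$3 *\<^sub>R N p)"
  have lin: "linear T"
    by (rule linearI) (simp_all add: T_def algebra_simps)
  have "c = 0" if "T c = 0" for c
  proof -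
    have "B (T c) (N p) = c$3 * \<epsilon>"
      by (simp add: T_def B_simps normal'[OF p] unit[OF p])
    then have c3: "c$3 = 0" using that sign by (auto simp: B_simps)
    have "(vector [c$1, c$2] :: real^2) = 0"
      by (rule frechet_eq_0[OF p]) (use that c3 in \<open>simp add: T_def\<close>)
    then show ?thesis using c3 by (simp add: vec_eq_iff forall_2 forall_3)
  qed
  then have "inj T" using linear_injective_0[OF lin] by blast
  then have "surj T" using linear_injective_imp_surjective[OF lin] by blast
  then obtain c where "z = T c" by blast
  then show "B w z = 0" by (simp add: T_def B_simps assms)
qed

text \<open>Tangential coordinates of \<open>w\<close>: the inverse metric raises the index of the
  covector \<open>B w (\<partial> m \<psi> p)\<close>.\<close>

definition coeff where
  "coeff p w l = (\<Sum>m\<in>UNIV. matrix_inv (g p) $ l $ m * B w (\<partial> m \<psi> p))"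

lemma g_coeff:
  assumes "p \<in> \<Omega>"
  shows "(\<Sum>l\<in>UNIV. g p $ k $ l * coeff p w l) = B w (\<partial> k \<psi> p)"
proof -
  have d: "det (g p) \<noteq> 0" using g_positive[OF assms] by simp
  have k: "k = 1 \<or> k = 2" by (rule exhaust_2)
  \<comment> \<open>Multiplied by the determinant, this is a polynomial identity, as in Cramer's
    rule.\<close>
  have "(\<Sum>l\<in>UNIV. g p $ k $ l * coeff p w l) * det (g p) = B w (\<partial> k \<psi> p) * det (g p)"
    using k d g_sym[of p 2 1]
    by (auto simp: sum_2 coeff_def matrix_inv_2[OF d] field_simps) (auto simp: det_2 algebra_simps)
  with d show ?thesis by simp
qed

text \<open>The difference of the two sides is orthogonal to the whole frame. The factor
  \<open>\<epsilon>\<close> stands for the reciprocal of \<open>B (N p) (N p)\<close>.\<close>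

lemma decomposition:
  assumes p: "p \<in> \<Omega>"
  shows "w = coeff p w 1 *\<^sub>R \<partial> 1 \<psi> p + coeff p w 2 *\<^sub>R \<partial> 2 \<psi> p + (\<epsilon> * B w (N p)) *\<^sub>R N p" (is "w = ?r")
proof -
  have "w - ?r = 0"
  proof (rule orthogonal_eq_0[OF p])
    show "B (w - ?r) (\<partial> i \<psi> p) = 0" for i
      using g_coeff[OF p, of i w]
      by (simp add: B_simps normal[OF p] sum_2 g_component commute[of "\<partial> i \<psi> p"] algebra_simps)
    show "B (w - ?r) (N p) = 0"
      using sign by (simp add: B_simps normal'[OF p] unit[OF p] algebra_simps)
  qed
  then show ?thesis by simp
qed

lemma normal_part_eq:
  assumes p: "p \<in> \<Omega>"
  shows "normal_part B \<psi> p w = (\<epsilon> * B w (N p)) *\<^sub>R N p"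
  unfolding normal_part_def
proof (rule the_equality, intro conjI allI)
  have "w - (\<epsilon> * B w (N p)) *\<^sub>R N p = coeff p w 1 *\<^sub>R \<partial> 1 \<psi> p + coeff p w 2 *\<^sub>R \<partial> 2 \<psi> p"
    using decomposition[OF p, of w] by (simp add: algebra_simps)
  also have "\<dots> = frechet_derivative \<psi> (at p) (vector [coeff p w 1, coeff p w 2])"
    by (simp add: frechet[OF p])
  finally show "w - (\<epsilon> * B w (N p)) *\<^sub>R N p \<in> range (frechet_derivative \<psi> (at p))" by simp
  show "B ((\<epsilon> * B w (N p)) *\<^sub>R N p) (frechet_derivative \<psi> (at p) v) = 0" for v
    by (simp add: frechet[OF p] B_simps normal[OF p])
next
  \<comment> \<open>Uniqueness: a competitor is orthogonal to the tangent vectors, hence a multiple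
    of \<open>N p\<close>, and tangency of \<open>w - n\<close> fixes the factor.\<close>
  fix n assume n: "w - n \<in> range (frechet_derivative \<psi> (at p)) \<and> (\<forall>v. B n (frechet_derivative \<psi> (at p) v) = 0)"
  then obtain v where v: "w - n = frechet_derivative \<psi> (at p) v" by blast
  have "B n (\<partial> i \<psi> p) = 0" for i using n by (simp add: partial_deriv_def)
  then have "n = (\<epsilon> * B n (N p)) *\<^sub>R N p"
    using decomposition[OF p, of n] by (simp add: coeff_def)
  moreover have "B (w - n) (N p) = 0" by (simp add: v frechet[OF p] B_simps normal'[OF p])
  ultimately show "n = (\<epsilon> * B w (N p)) *\<^sub>R N p" by (simp add: B_simps)
qed

lemma mean_curvature_vector_eq:
  assumes "p \<in> \<Omega>"
  shows "mean_curvature_vector B \<psi> p = (\<epsilon> * H p) *\<^sub>R N p"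
  unfolding mean_curvature_vector_def second_fundamental_form_def H_def
  by (simp add: normal_part_eq[OF assms] h_def sum_2 algebra_simps)

section \<open>Derivatives of the normal and the shape operator\<close>

lemma smooth_partial: "smooth_on \<Omega> (\<partial> i \<psi>)" and smooth_partial2: "smooth_on \<Omega> (\<partial> i (\<partial> j \<psi>))"
  by (intro smooth_on_partial smooth)+

lemma partial_differentiable:
  "p \<in> \<Omega> \<Longrightarrow> \<partial> i \<psi> differentiable at p" "p \<in> \<Omega> \<Longrightarrow> \<partial> i (\<partial> j \<psi>) differentiable at p"
  using smooth_partial smooth_partial2 smooth_on_differentiable by blast+

lemma partial2_commute: "p \<in> \<Omega> \<Longrightarrow> \<partial> i (\<partial> j \<psi>) p = \<partial> j (\<partial> i \<psi>) p"
  by (rule smooth_on_partial_commute[OF open_domain _ smooth])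

lemma h_sym: "p \<in> \<Omega> \<Longrightarrow> h p $ i $ j = h p $ j $ i"
  by (simp add: h_def partial2_commute)

text \<open>Comes from differentiating the orthogonality of \<open>N\<close> and
  \<open>\<partial> j \<psi>\<close>. It trades second derivatives of the surface for first
  derivatives of \<open>N\<close>.\<close>

lemma weingarten:
  assumes p: "p \<in> \<Omega>"
  shows "B (\<partial> i N p) (\<partial> j \<psi> p) = - h p $ i $ j"
proof -
  have "\<partial> i (\<lambda>q. B (N q) (\<partial> j \<psi> q)) p = \<partial> i (\<lambda>q. 0::real) p"
    by (rule partial_cong[OF open_domain p]) (simp add: normal)
  then show ?thesis
    unfolding partial_bilinear[OF bilinear N_differentiable[OF p] partial_differentiable(1)[OF p]]
    by (simp add: partial_deriv_def[of i "\<lambda>q. 0::real"] h_def commute)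
qed

lemma partial_N_tangent:
  assumes p: "p \<in> \<Omega>"
  shows "B (\<partial> i N p) (N p) = 0"
proof -
  have "\<partial> i (\<lambda>q. B (N q) (N q)) p = \<partial> i (\<lambda>q. \<epsilon>) p"
    by (rule partial_cong[OF open_domain p]) (simp add: unit)
  then show ?thesis
    unfolding partial_bilinear[OF bilinear N_differentiable[OF p] N_differentiable[OF p]]
    by (simp add: partial_deriv_def[of i "\<lambda>q. \<epsilon>"] commute)
qed

text \<open>The derivative of \<open>N\<close> is tangent because \<open>N\<close> has constant
  square, so it is determined by its tangential coordinates, which the Weingarten equation expresses
  through \<open>h\<close>.\<close>

lemma frechet_shape:
  assumes p: "p \<in> \<Omega>"
  shows "frechet_derivative \<psi> (at p) ((matrix_inv (g p) ** h p) *v v) = - frechet_derivative N (at p) v"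
    (is "_ (?A *v v) = ?w")
proof -
  have w: "?w = - (v$1 *\<^sub>R \<partial> 1 N p + v$2 *\<^sub>R \<partial> 2 N p)"
    by (simp add: partial_eq_frechet[OF N_differentiable[OF p]])
  have "B ?w (N p) = 0" unfolding w by (simp add: B_simps partial_N_tangent[OF p])
  then have "?w = coeff p ?w 1 *\<^sub>R \<partial> 1 \<psi> p + coeff p ?w 2 *\<^sub>R \<partial> 2 \<psi> p"
    using decomposition[OF p, of ?w] by simp
  moreover have "coeff p ?w l = (?A *v v) $ l" for l
    unfolding w coeff_def
    by (simp add: B_simps weingarten[OF p] matrix_vector_mult_def matrix_matrix_mult_def sum_2 h_sym[OF p, of 2 1] algebra_simps)
  ultimately show ?thesis by (simp add: frechet[OF p])
qed

lemma shape_operator_eq: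
  assumes p: "p \<in> \<Omega>"
  shows "shape_operator \<psi> N p = matrix_inv (g p) ** h p" (is "_ = ?A")
  unfolding shape_operator_def
proof (rule the_equality)
  fix A assume A: "\<forall>v. frechet_derivative \<psi> (at p) (A *v v) = - frechet_derivative N (at p) v"
  have "A *v v = ?A *v v" for v
  proof -
    have "frechet_derivative \<psi> (at p) (A *v v) = frechet_derivative \<psi> (at p) (?A *v v)"
      using A by (simp add: frechet_shape[OF p])
    then have "(A *v v - ?A *v v) $ 1 *\<^sub>R \<partial> 1 \<psi> p + (A *v v - ?A *v v) $ 2 *\<^sub>R \<partial> 2 \<psi> p = 0"
      by (simp add: frechet[OF p] algebra_simps)
    from frechet_eq_0[OF p this] show ?thesis by simp
  qed
  then show "A = ?A" by (simp add: matrix_eq)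
qed (simp add: frechet_shape[OF p])

lemma mean_curvature_eq:
  assumes p: "p \<in> \<Omega>"
  shows "mean_curvature \<psi> N p = H p"
  unfolding mean_curvature_def shape_operator_eq[OF p] H_def
  by (simp add: trace_def matrix_matrix_mult_def sum_2 h_sym[OF p, of 2 1])

section \<open>Christoffel symbols and the Gauss equation\<close>

lemma partial_g:
  "p \<in> \<Omega> \<Longrightarrow> \<partial> i (\<lambda>q. g q $ j $ k) p =
     B (\<partial> j \<psi> p) (\<partial> i (\<partial> k \<psi>) p) + B (\<partial> i (\<partial> j \<psi>) p) (\<partial> k \<psi> p)"
  unfolding g_component by (intro partial_bilinear bilinear partial_differentiable)

lemma smooth_g: "smooth_on \<Omega> (\<lambda>p. g p $ i $ j)"
  unfolding g_component by (rule smooth_on_bilinear[OF open_domain bilinear smooth_partial smooth_partial])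

text \<open>By symmetry of second derivatives, all but two equal terms of the Koszul combination
  cancel. The Christoffel symbols are thus the tangential coordinates of the second derivatives of
  \<open>\<psi>\<close>.\<close>

lemma christoffel_eq:
  assumes p: "p \<in> \<Omega>"
  shows "christoffel g l i j p = coeff p (\<partial> i (\<partial> j \<psi>) p) l"
proof -
  have "\<partial> i (\<lambda>q. g q $ j $ m) p + \<partial> j (\<lambda>q. g q $ i $ m) p - \<partial> m (\<lambda>q. g q $ i $ j) p =
      2 * B (\<partial> i (\<partial> j \<psi>) p) (\<partial> m \<psi> p)" for m
    unfolding partial_g[OF p] partial2_commute[OF p, of j i] partial2_commute[OF p, of m i]
      partial2_commute[OF p, of m j] commute[of "\<partial> i \<psi> p"] commute[of "\<partial> j \<psi> p"]
    by simp
  then show ?thesis unfolding christoffel_def coeff_def by (simp add: sum_2)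
qed

lemma smooth_matrix_inv_g: "smooth_on \<Omega> (\<lambda>p. matrix_inv (g p) $ l $ m)"
proof -
  have det: "smooth_on \<Omega> (\<lambda>p. g p $ 1 $ 1 * g p $ 2 $ 2 + - (g p $ 1 $ 2 * g p $ 2 $ 1))"
    by (intro smooth_on_add smooth_on_uminus smooth_on_mult open_domain smooth_g)
  have "smooth_on \<Omega> (\<lambda>p. det (g p))"
    by (rule smooth_on_cong[OF open_domain _ det]) (simp add: det_2)
  then have i: "smooth_on \<Omega> (\<lambda>p. 1 / det (g p))"
    by (rule smooth_on_inverse[OF open_domain]) (simp add: g_positive)
  have c: "smooth_on \<Omega> (\<lambda>p. g p $ a $ b * (1 / det (g p)))" "smooth_on \<Omega> (\<lambda>p. - g p $ a $ b * (1 / det (g p)))" for a b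
    by (intro smooth_on_mult smooth_on_uminus i smooth_g open_domain)+
  have d: "p \<in> \<Omega> \<Longrightarrow> det (g p) \<noteq> 0" for p using g_positive by fastforce
  have "l = 1 \<or> l = 2" "m = 1 \<or> m = 2" by (rule exhaust_2)+
  then show ?thesis
    apply (elim disjE)
    apply (rule smooth_on_cong[OF open_domain _ c(1)[of 2 2]], simp add: matrix_inv_2 d)
    apply (rule smooth_on_cong[OF open_domain _ c(2)[of 1 2]], simp add: matrix_inv_2 d)
    apply (rule smooth_on_cong[OF open_domain _ c(2)[of 2 1]], simp add: matrix_inv_2 d)
    apply (rule smooth_on_cong[OF open_domain _ c(1)[of 1 1]], simp add: matrix_inv_2 d)
    done
qed

lemma christoffel_differentiable:
  assumes "p \<in> \<Omega>"
  shows "christoffel g l i j differentiable at p"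
proof -
  have "smooth_on \<Omega> (\<lambda>p. matrix_inv (g p) $ l $ 1 * B (\<partial> i (\<partial> j \<psi>) p) (\<partial> 1 \<psi> p) +
      matrix_inv (g p) $ l $ 2 * B (\<partial> i (\<partial> j \<psi>) p) (\<partial> 2 \<psi> p))"
    by (intro smooth_on_add smooth_on_mult smooth_matrix_inv_g smooth_on_bilinear[OF _ bilinear]
        smooth_partial smooth_partial2 open_domain)
  then have "smooth_on \<Omega> (christoffel g l i j)"
    by (rule smooth_on_cong[OF open_domain, rotated]) (simp add: christoffel_eq coeff_def sum_2)
  then show ?thesis using smooth_on_differentiable assms by blast
qed

lemma g_christoffel:
  "p \<in> \<Omega> \<Longrightarrow> (\<Sum>l\<in>UNIV. g p $ k $ l * christoffel g l i j p) = B (\<partial> i (\<partial> j \<psi>) p) (\<partial> k \<psi> p)"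
  by (simp add: christoffel_eq g_coeff)

text \<open>Differentiating the lowered identity \<open>g_christoffel\<close> avoids derivatives of
  the inverse metric, and the first index of \<open>riemann\<close> is lowered in
  \<open>gauss_curvature\<close> anyway.\<close>

lemma partial_g_christoffel:
  assumes p: "p \<in> \<Omega>"
  shows "(\<Sum>l\<in>UNIV. g p $ k $ l * \<partial> m (christoffel g l i j) p) =
    B (\<partial> i (\<partial> j \<psi>) p) (\<partial> m (\<partial> k \<psi>) p) + B (\<partial> m (\<partial> i (\<partial> j \<psi>)) p) (\<partial> k \<psi> p) -
    (\<Sum>l\<in>UNIV. \<partial> m (\<lambda>q. g q $ k $ l) p * christoffel g l i j p)"
proof -
  have g: "(\<lambda>q. g q $ k $ l) differentiable at p" for l
    using smooth_on_differentiable[OF smooth_g p] .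
  have d: "(\<lambda>q. g q $ k $ l * christoffel g l i j q) differentiable at p" for l
    using frechet_derivative_bilinear(1)[OF bounded_bilinear_mult g christoffel_differentiable[OF p]] .
  have "\<partial> m (\<lambda>q. \<Sum>l\<in>UNIV. g q $ k $ l * christoffel g l i j q) p =
      \<partial> m (\<lambda>q. B (\<partial> i (\<partial> j \<psi>) q) (\<partial> k \<psi> q)) p"
    by (rule partial_cong[OF open_domain p]) (simp add: g_christoffel)
  also have "\<dots> = B (\<partial> i (\<partial> j \<psi>) p) (\<partial> m (\<partial> k \<psi>) p) + B (\<partial> m (\<partial> i (\<partial> j \<psi>)) p) (\<partial> k \<psi> p)"
    by (intro partial_bilinear bilinear partial_differentiable p)
  also have "\<partial> m (\<lambda>q. \<Sum>l\<in>UNIV. g q $ k $ l * christoffel g l i j q) p =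
      (\<Sum>l\<in>UNIV. \<partial> m (\<lambda>q. g q $ k $ l * christoffel g l i j q) p)"
    unfolding sum_2 partial_deriv_def by (rule frechet_derivative_plus[OF d d])
  also have "\<dots> = (\<Sum>l\<in>UNIV. g p $ k $ l * \<partial> m (christoffel g l i j) p +
      \<partial> m (\<lambda>q. g q $ k $ l) p * christoffel g l i j p)"
    by (intro sum.cong refl partial_bilinear[OF bounded_bilinear_mult] g christoffel_differentiable p)
  finally show ?thesis by (simp add: sum.distrib)
qed

theorem gauss_equation:
  assumes p: "p \<in> \<Omega>"
  shows "gauss_curvature g p = \<epsilon> * det (h p) / det (g p)"
proof -
  let ?X = "\<lambda>i j. \<partial> i (\<partial> j \<psi>) p" and ?G = "\<lambda>l i j. christoffel g l i j p"
  have third: "\<partial> 1 (\<partial> 2 (\<partial> 2 \<psi>)) p = \<partial> 2 (\<partial> 1 (\<partial> 2 \<psi>)) p"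
    by (rule smooth_on_partial_commute[OF open_domain p smooth_partial])
  have first: "B (\<partial> 1 \<psi> p) (?X i j) = B (?X i j) (\<partial> 1 \<psi> p)" "B (?X 2 2) (?X 1 1) = B (?X 1 1) (?X 2 2)" for i j
    by (rule commute)+
  \<comment> \<open>Only the second argument is split, so that the tangential parts reproduce the
    Christoffel terms of the curvature and only products of entries of \<open>h\<close>
    survive.\<close>
  have dec: "B w (?X i j) = ?G 1 i j * B w (\<partial> 1 \<psi> p) + ?G 2 i j * B w (\<partial> 2 \<psi> p) + \<epsilon> * h p $ i $ j * B w (N p)"
    for w i j
    by (subst decomposition[OF p, of "?X i j"]) (simp add: B_simps christoffel_eq[OF p] h_def)
  have "(\<Sum>l\<in>UNIV. g p $ 1 $ l * riemann g l 2 1 2 p) =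
      (\<Sum>l\<in>UNIV. g p $ 1 $ l * \<partial> 1 (christoffel g l 2 2) p)
      - (\<Sum>l\<in>UNIV. g p $ 1 $ l * \<partial> 2 (christoffel g l 1 2) p)
      + (\<Sum>m\<in>UNIV. (\<Sum>l\<in>UNIV. g p $ 1 $ l * ?G l 1 m) * ?G m 2 2)
      - (\<Sum>m\<in>UNIV. (\<Sum>l\<in>UNIV. g p $ 1 $ l * ?G l 2 m) * ?G m 1 2)"
    unfolding riemann_def by (simp add: sum_2 algebra_simps)
  \<comment> \<open>The third derivatives cancel by \<open>third\<close>; one half of each metric
    derivative cancels a quadratic Christoffel term.\<close>
  also have "\<dots> = B (?X 1 1) (?X 2 2) - B (?X 1 2) (?X 1 2)
      - (?G 1 2 2 * B (?X 1 1) (\<partial> 1 \<psi> p) + ?G 2 2 2 * B (?X 1 1) (\<partial> 2 \<psi> p))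
      + (?G 1 1 2 * B (?X 1 2) (\<partial> 1 \<psi> p) + ?G 2 1 2 * B (?X 1 2) (\<partial> 2 \<psi> p))"
    unfolding partial_g_christoffel[OF p] g_christoffel[OF p] partial_g[OF p] third sum_2
      partial2_commute[OF p, of 2 1] first
    by (simp add: algebra_simps)
  also have "\<dots> = \<epsilon> * det (h p)"
    by (simp add: dec[of _ 2 2] dec[of "?X 1 2" 1 2] det_2 h_sym[OF p, of 2 1])
      (simp add: h_def algebra_simps)
  finally show ?thesis unfolding gauss_curvature_def by simp
qed

end

section \<open>Smoothness of inverse functions\<close>

lemma smooth_on_sum:
  assumes "open S" "\<And>i. i \<in> A \<Longrightarrow> smooth_on S (f i)"
  shows "smooth_on S (\<lambda>x. \<Sum>i\<in>A. f i x)"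
  using assms(2)
  by (induction A rule: infinite_finite_induct) (auto intro: smooth_on_add smooth_on_const assms(1))

text \<open>Invariance of domain makes the image open, and the right inverse \<open>R x\<close> of
  \<open>G' x\<close> is then the derivative of the inverse map. A directional derivative of
  \<open>k\<close> after the inverse is again a smooth function after the inverse, namely the
  derivative of \<open>k\<close> at \<open>x\<close> along \<open>R x v\<close>, so the bootstrap
  applies.\<close>

lemma smooth_on_inverse_function:
  fixes G :: "'n::euclidean_space \<Rightarrow> 'n" and k :: "'n \<Rightarrow> real"
  assumes "open S" "inj_on G S"
    and G: "\<And>x. x \<in> S \<Longrightarrow> (G has_derivative G' x) (at x)"
    and R: "\<And>x. x \<in> S \<Longrightarrow> G' x \<circ> R x = id" "\<And>v. smooth_on S (\<lambda>x. R x v)"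
    and k: "smooth_on S k"
  shows "open (G ` S)" "smooth_on (G ` S) (\<lambda>y. k (inv_into S G y))"
    "\<And>x. x \<in> S \<Longrightarrow> (inv_into S G has_derivative R x) (at (G x))"
proof -
  have cont: "continuous_on S G"
    using G by (meson continuous_at_imp_continuous_on has_derivative_continuous)
  show o: "open (G ` S)" by (rule invariance_of_domain[OF cont assms(1,2)])
  show inv: "(inv_into S G has_derivative R x) (at (G x))" if "x \<in> S" for x
    by (rule has_derivative_inverse_strong[OF assms(1) that cont _ G[OF that] R(1)[OF that]])
      (simp add: assms(2))
  show "smooth_on (G ` S) (\<lambda>y. k (inv_into S G y))"
  proof (rule smooth_on_bootstrap[OF o _ k])
    fix k :: "'n \<Rightarrow> real" assume k: "smooth_on S k"
    have d: "((\<lambda>y. k (inv_into S G y)) has_derivative (\<lambda>v. frechet_derivative k (at x) (R x v))) (at (G x))"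
      if "x \<in> S" for x
    proof -
      have "(k has_derivative frechet_derivative k (at x)) (at (inv_into S G (G x)))"
        using smooth_on_differentiable[OF k that] that assms(2) by (simp add: frechet_derivative_works)
      from diff_chain_at[OF inv[OF that] this] show ?thesis by (simp add: o_def)
    qed
    have "smooth_on S (\<lambda>x. frechet_derivative k (at x) (R x v))" for v
    proof (rule smooth_on_cong[OF assms(1)])
      \<comment> \<open>Expanding the moving direction \<open>R x v\<close> in a basis leaves
        derivatives of \<open>k\<close> in fixed directions with smooth coefficients.\<close>
      show "smooth_on S (\<lambda>x. \<Sum>b\<in>Basis. (R x v \<bullet> b) *\<^sub>R frechet_derivative k (at x) b)"
        by (intro smooth_on_sum smooth_on_scaleR smooth_on_frechet k
            smooth_on_linear[OF _ bounded_linear_inner_left] R assms(1))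
      fix x assume "x \<in> S"
      then have l: "linear (frechet_derivative k (at x))"
        using smooth_on_differentiable[OF k] linear_frechet_derivative by blast
      show "(\<Sum>b\<in>Basis. (R x v \<bullet> b) *\<^sub>R frechet_derivative k (at x) b) = frechet_derivative k (at x) (R x v)"
        by (subst (2) euclidean_representation[of "R x v", symmetric])
          (simp only: linear_sum[OF l] linear_scale[OF l])
    qed
    moreover have "\<forall>y\<in>G ` S. frechet_derivative (\<lambda>y. k (inv_into S G y)) (at y) v =
        frechet_derivative k (at (inv_into S G y)) (R (inv_into S G y) v)" for v
      using assms(2) by (auto simp: frechet_derivative_eqI[OF d])
    moreover have "\<forall>y\<in>G ` S. (\<lambda>y. k (inv_into S G y)) differentiable at y"
      using d by (auto intro: differentiableI)
    ultimately show "(\<forall>y\<in>G ` S. (\<lambda>y. k (inv_into S G y)) differentiable at y) \<and>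
       (\<forall>v. \<exists>k'. smooth_on S k' \<and>
         (\<forall>y\<in>G ` S. frechet_derivative (\<lambda>y. k (inv_into S G y)) (at y) v = k' (inv_into S G y)))"
      by blast
  qed
qed

section \<open>Maps given by their coordinates\<close>

lemma vector_3_axis:
  "(vector [a, b, c] :: real^3) = a *\<^sub>R axis 1 1 + b *\<^sub>R axis 2 1 + c *\<^sub>R axis 3 1"
  by (simp add: vec_eq_iff forall_3 axis_def)

lemma vector_2_axis: "(vector [a, b] :: real^2) = a *\<^sub>R axis 1 1 + b *\<^sub>R axis 2 1"
  by (simp add: vec_eq_iff forall_2 axis_def)

lemma smooth_on_vector_3:
  assumes "open S" "smooth_on S a" "smooth_on S b" "smooth_on S c"
  shows "smooth_on S (\<lambda>x. vector [a x, b x, c x] :: real^3)"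
  unfolding vector_3_axis by (intro smooth_on_add smooth_on_scaleR smooth_on_const assms)

lemma smooth_on_vector_2:
  assumes "open S" "smooth_on S a" "smooth_on S b"
  shows "smooth_on S (\<lambda>x. vector [a x, b x] :: real^2)"
  unfolding vector_2_axis by (intro smooth_on_add smooth_on_scaleR smooth_on_const assms)

lemma partial_component:
  fixes f :: "real^2 \<Rightarrow> real^'n"
  assumes "f differentiable at p"
  shows "\<partial> i f p $ k = \<partial> i (\<lambda>q. f q $ k) p"
  unfolding partial_deriv_def by (rule frechet_derivative_linear(2)[OF bounded_linear_vec_nth assms, symmetric])

lemma partial_vector_3:
  assumes "open S" "p \<in> S" "smooth_on S a" "smooth_on S b" "smooth_on S c"
  shows "\<partial> i (\<lambda>x. vector [a x, b x, c x] :: real^3) p = vector [\<partial> i a p, \<partial> i b p, \<partial> i c p]"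
  using partial_component[OF smooth_on_differentiable[OF smooth_on_vector_3[OF assms(1,3-5)] assms(2)]]
  by (simp add: vec_eq_iff forall_3)

lemma partial_vector_2:
  assumes "open S" "p \<in> S" "smooth_on S a" "smooth_on S b"
  shows "\<partial> i (\<lambda>x. vector [a x, b x] :: real^2) p = vector [\<partial> i a p, \<partial> i b p]"
  using partial_component[OF smooth_on_differentiable[OF smooth_on_vector_2[OF assms(1,3-4)] assms(2)]]
  by (simp add: vec_eq_iff forall_2)

lemma partial_const: "\<partial> i (\<lambda>_. c) p = 0"
  by (simp add: partial_deriv_def)

lemma partial_coordinate: "\<partial> i (\<lambda>p. p $ k) p = axis i 1 $ k"
  unfolding partial_deriv_def
  by (simp add: frechet_derivative_eqI[OF bounded_linear.has_derivative[OF bounded_linear_vec_nth has_derivative_ident]])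

lemma smooth_on_coordinate: "open S \<Longrightarrow> smooth_on S (\<lambda>p::real^2. p $ k)"
proof (rule smooth_onI_partial)
  show "(\<lambda>p::real^2. p $ k) differentiable at x" for x
    by (intro bounded_linear_imp_differentiable bounded_linear_vec_nth)
qed (simp_all add: partial_coordinate[abs_def] smooth_on_const)

section \<open>The Lorentz form and gradients of functions of the height\<close>

lemma lorentz_bilinear: "bounded_bilinear lorentz"
proof -
  have "bilinear lorentz"
    unfolding bilinear_def lorentz_def by (auto intro!: linearI simp: algebra_simps)
  then show ?thesis by (simp add: bilinear_conv_bounded_bilinear)
qed

lemma lorentz_commute: "lorentz v w = lorentz w v"
  by (simp add: lorentz_def)

lemma lorentz_nondegenerate:
  assumes "\<And>z. lorentz w z = 0"
  shows "w = 0"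
  using assms[of "axis 1 1"] assms[of "axis 2 1"] assms[of "axis 3 1"]
  by (simp add: lorentz_def vec_eq_iff forall_3 axis_def)

lemma ambient_gradient_eqI:
  assumes "\<And>v. B w v = frechet_derivative F (at x) v"
    "bounded_bilinear B" "\<And>w. (\<And>z. B w z = 0) \<Longrightarrow> w = 0"
  shows "ambient_gradient B F x = w"
  unfolding ambient_gradient_def
proof (rule the_equality)
  fix w' assume "\<forall>v. B w' v = frechet_derivative F (at x) v"
  then have "B (w' - w) z = 0" for z using assms(1) by (simp add: bounded_bilinear.diff_left[OF assms(2)])
  then show "w' = w" using assms(3) by fastforce
qed (use assms(1) in simp)

lemma frechet_height:
  fixes f :: "real \<Rightarrow> real" and x :: "real^3"
  assumes "f differentiable at (x $ 3)"
  shows "frechet_derivative (\<lambda>x. f (x $ 3)) (at x) v = v $ 3 * frechet_derivative f (at (x $ 3)) 1"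
proof -
  have d: "((\<lambda>x::real^3. x $ 3) has_derivative (\<lambda>v. v $ 3)) (at x)"
    by (rule bounded_linear_imp_has_derivative[OF bounded_linear_vec_nth])
  then have "(\<lambda>x::real^3. x $ 3) differentiable at x" by (auto simp: differentiable_def)
  from frechet_derivative_real_compose(2)[OF this assms] show ?thesis
    by (simp add: frechet_derivative_eqI[OF d])
qed

lemma ambient_gradient_height:
  assumes "f differentiable at (x $ 3)"
  shows "ambient_gradient (\<bullet>) (\<lambda>x. f (x $ 3)) x = vector [0, 0, frechet_derivative f (at (x $ 3)) 1]"
    "ambient_gradient lorentz (\<lambda>x. f (x $ 3)) x = vector [0, 0, - frechet_derivative f (at (x $ 3)) 1]"
proof -
  show "ambient_gradient (\<bullet>) (\<lambda>x. f (x $ 3)) x = vector [0, 0, frechet_derivative f (at (x $ 3)) 1]"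
  proof (rule ambient_gradient_eqI[OF _ bounded_bilinear_inner])
    show "w = 0" if "\<And>z. w \<bullet> z = 0" for w :: "real^3" using that[of w] by simp
  qed (simp add: frechet_height[OF assms] inner_vec_def sum_3)
  show "ambient_gradient lorentz (\<lambda>x. f (x $ 3)) x = vector [0, 0, - frechet_derivative f (at (x $ 3)) 1]"
    by (rule ambient_gradient_eqI[OF _ lorentz_bilinear lorentz_nondegenerate])
      (simp_all add: frechet_height[OF assms] lorentz_def)
qed

section \<open>The two surfaces of the Hessian system\<close>

locale hessian_system =
  fixes I :: "real set" and varphi \<theta> :: "real \<Rightarrow> real" and \<Omega> :: "(real^2) set"
    and u phi W :: "real^2 \<Rightarrow> real"
  assumes open_I: "open I" and interval_I: "is_interval I" and smooth_varphi: "smooth_on I varphi"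
    and open_domain: "open \<Omega>" and smooth_u: "smooth_on \<Omega> u" and u_I: "\<And>p. p \<in> \<Omega> \<Longrightarrow> u p \<in> I"
    and W: "W = (\<lambda>p. sqrt (1 + (\<partial> 1 u p)\<^sup>2 + (\<partial> 2 u p)\<^sup>2))"
    and phi_C2: "Ck_on 2 \<Omega> phi"
    and phi_xx: "\<And>p. p \<in> \<Omega> \<Longrightarrow>
          \<partial> 1 (\<partial> 1 phi) p = (1 + (\<partial> 1 u p)\<^sup>2) / W p * exp (varphi (u p))"
    and phi_xy: "\<And>p. p \<in> \<Omega> \<Longrightarrow>
          \<partial> 2 (\<partial> 1 phi) p = \<partial> 1 u p * \<partial> 2 u p / W p * exp (varphi (u p))"
    and phi_yy: "\<And>p. p \<in> \<Omega> \<Longrightarrow>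
          \<partial> 2 (\<partial> 2 phi) p = (1 + (\<partial> 2 u p)\<^sup>2) / W p * exp (varphi (u p))"
    and theta: "\<And>t. t \<in> I \<Longrightarrow> (\<theta> has_real_derivative exp (varphi t)) (at t)"
begin

definition E :: "real^2 \<Rightarrow> real" where "E p = exp (varphi (u p))"

definition \<psi> :: "real^2 \<Rightarrow> real^3" where "\<psi> = (\<lambda>p. vector [p $ 1, p $ 2, u p])"
definition \<psi>' :: "real^2 \<Rightarrow> real^3" where "\<psi>' = (\<lambda>p. vector [\<partial> 1 phi p, \<partial> 2 phi p, \<theta> (u p)])"
definition N :: "real^2 \<Rightarrow> real^3" where "N = (\<lambda>p. (1 / W p) *\<^sub>R vector [- \<partial> 1 u p, - \<partial> 2 u p, 1])"
definition N' :: "real^2 \<Rightarrow> real^3" where "N' = (\<lambda>p. vector [\<partial> 1 u p, \<partial> 2 u p, W p])"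

section \<open>Regularity of the data\<close>

lemma W_square: "W p * W p = 1 + (\<partial> 1 u p)\<^sup>2 + (\<partial> 2 u p)\<^sup>2"
  unfolding W by simp

lemma W_pos: "W p > 0"
  unfolding W by (simp add: add_pos_nonneg)

lemma E_pos: "E p > 0"
  by (simp add: E_def)

lemma smooth_du: "smooth_on \<Omega> (\<partial> i u)"
  by (rule smooth_on_partial[OF smooth_u])

lemma smooth_W: "smooth_on \<Omega> W"
proof (rule smooth_on_cong[OF open_domain])
  have "smooth_on \<Omega> (\<lambda>p. 1 + \<partial> 1 u p * \<partial> 1 u p + \<partial> 2 u p * \<partial> 2 u p)"
    by (intro smooth_on_add smooth_on_mult smooth_on_const smooth_du open_domain)
  then show "smooth_on \<Omega> (\<lambda>p. (1 + \<partial> 1 u p * \<partial> 1 u p + \<partial> 2 u p * \<partial> 2 u p) powr (1 / 2))"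
    by (rule smooth_on_real_compose[OF open_domain smooth_on_powr]) (auto simp: add_pos_nonneg)
qed (simp add: W powr_half_sqrt power2_eq_square)

lemma smooth_inverse_W: "smooth_on \<Omega> (\<lambda>p. 1 / W p)"
  by (intro smooth_on_inverse open_domain smooth_W W_pos)

lemma smooth_E: "smooth_on \<Omega> E"
  unfolding E_def[abs_def]
  by (intro smooth_on_real_compose[OF open_domain smooth_on_exp] smooth_on_real_compose[OF open_domain smooth_varphi] smooth_u)
    (use u_I in auto)

lemma smooth_theta: "smooth_on I \<theta>"
proof (rule smooth_onI)
  fix v
  have f: "frechet_derivative \<theta> (at t) v = exp (varphi t) * v" if "t \<in> I" for t
    using frechet_derivative_eqI[OF has_field_derivative_imp_has_derivative[OF theta[OF that]]] by simp
  have "smooth_on I (\<lambda>t. exp (varphi t) * v)"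
    by (intro smooth_on_mult open_I smooth_on_real_compose[OF open_I smooth_on_exp] smooth_varphi smooth_on_const) auto
  then show "smooth_on I (\<lambda>t. frechet_derivative \<theta> (at t) v)"
    by (rule smooth_on_cong[OF open_I, rotated]) (simp add: f)
qed (rule differentiableI[OF has_field_derivative_imp_has_derivative[OF theta]])

lemma smooth_theta_u: "smooth_on \<Omega> (\<lambda>p. \<theta> (u p))"
  by (rule smooth_on_real_compose[OF open_domain smooth_theta smooth_u]) (use u_I in auto)

lemma partial_theta_u:
  assumes p: "p \<in> \<Omega>"
  shows "\<partial> i (\<lambda>p. \<theta> (u p)) p = E p * \<partial> i u p"
proof -
  have t: "(\<theta> has_derivative (*) (E p)) (at (u p))"
    unfolding E_def by (rule has_field_derivative_imp_has_derivative[OF theta[OF u_I[OF p]]])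
  then have "\<theta> differentiable at (u p)" by (auto simp: differentiable_def)
  from frechet_derivative_real_compose(2)[OF smooth_on_differentiable[OF smooth_u p] this]
  show ?thesis unfolding partial_deriv_def by (simp add: frechet_derivative_eqI[OF t])
qed

text \<open>Symmetry of second derivatives supplies the remaining mixed entry. In this form the
  matrix is visibly \<open>E p / W p\<close> times the induced metric of
  \<open>\<psi>\<close>.\<close>

lemma hessian:
  assumes "p \<in> \<Omega>"
  shows "\<partial> 1 (\<partial> 1 phi) p = E p / W p * (1 + (\<partial> 1 u p)\<^sup>2)"
    "\<partial> 1 (\<partial> 2 phi) p = E p / W p * (\<partial> 1 u p * \<partial> 2 u p)"
    "\<partial> 2 (\<partial> 1 phi) p = E p / W p * (\<partial> 1 u p * \<partial> 2 u p)"
    "\<partial> 2 (\<partial> 2 phi) p = E p / W p * (1 + (\<partial> 2 u p)\<^sup>2)"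
  using phi_xx phi_xy phi_yy partial_commute[OF open_domain assms phi_C2, of 1 2] assms
  by (simp_all add: E_def)

text \<open>\<open>phi\<close> is assumed to be of class C^2; the system expresses its second
  derivatives through \<open>E\<close>, \<open>W\<close> and the first derivatives of
  \<open>u\<close>, which are smooth, and this lifts its gradient to full smoothness.\<close>

lemma smooth_dphi: "smooth_on \<Omega> (\<partial> i phi)"
proof (rule smooth_onI_partial[OF open_domain])
  show "\<partial> i phi differentiable at p" if "p \<in> \<Omega>" for p
    using phi_C2 that unfolding partial_deriv_def[abs_def] by (simp add: numeral_2_eq_2)
  have s: "smooth_on \<Omega> (\<lambda>p. E p * (1 / W p) * (1 + \<partial> 1 u p * \<partial> 1 u p))"
    "smooth_on \<Omega> (\<lambda>p. E p * (1 / W p) * (\<partial> 1 u p * \<partial> 2 u p))"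
    "smooth_on \<Omega> (\<lambda>p. E p * (1 / W p) * (1 + \<partial> 2 u p * \<partial> 2 u p))"
    by (intro smooth_on_add smooth_on_mult smooth_on_const smooth_du open_domain smooth_E smooth_inverse_W)+
  have "smooth_on \<Omega> (\<partial> 1 (\<partial> 1 phi))" "smooth_on \<Omega> (\<partial> 1 (\<partial> 2 phi))"
    "smooth_on \<Omega> (\<partial> 2 (\<partial> 1 phi))" "smooth_on \<Omega> (\<partial> 2 (\<partial> 2 phi))"
    using s by (auto intro: smooth_on_cong[OF open_domain, rotated] simp: hessian power2_eq_square)
  then show "smooth_on \<Omega> (\<partial> 1 (\<partial> i phi))" "smooth_on \<Omega> (\<partial> 2 (\<partial> i phi))"
    using exhaust_2[of i] by auto
qed

lemma smooth_psi: "smooth_on \<Omega> \<psi>"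
  unfolding \<psi>_def by (intro smooth_on_vector_3 smooth_on_coordinate smooth_u open_domain)

lemma smooth_psi': "smooth_on \<Omega> \<psi>'"
  unfolding \<psi>'_def by (intro smooth_on_vector_3 smooth_dphi smooth_theta_u open_domain)

section \<open>Tangent vectors, induced metrics and unit normals\<close>

lemma partial_psi: "p \<in> \<Omega> \<Longrightarrow> \<partial> i \<psi> p = vector [axis i 1 $ 1, axis i 1 $ 2, \<partial> i u p]"
  unfolding \<psi>_def
  by (subst partial_vector_3[OF open_domain _ smooth_on_coordinate[OF open_domain] smooth_on_coordinate[OF open_domain] smooth_u])
    (simp_all add: partial_coordinate)

lemma partial2_psi:
  assumes p: "p \<in> \<Omega>"
  shows "\<partial> i (\<partial> j \<psi>) p = vector [0, 0, \<partial> i (\<partial> j u) p]"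
proof -
  have "\<partial> i (\<partial> j \<psi>) p = \<partial> i (\<lambda>p. vector [axis j 1 $ 1, axis j 1 $ 2, \<partial> j u p] :: real^3) p"
    by (rule partial_cong[OF open_domain p partial_psi])
  also have "\<dots> = vector [0, 0, \<partial> i (\<partial> j u) p]"
    by (subst partial_vector_3[OF open_domain p smooth_on_const[OF open_domain] smooth_on_const[OF open_domain] smooth_du])
      (simp add: partial_const)
  finally show ?thesis .
qed

lemma partial_psi': "p \<in> \<Omega> \<Longrightarrow> \<partial> i \<psi>' p = vector [\<partial> i (\<partial> 1 phi) p, \<partial> i (\<partial> 2 phi) p, E p * \<partial> i u p]"
  unfolding \<psi>'_def
  by (subst partial_vector_3[OF open_domain _ smooth_dphi smooth_dphi smooth_theta_u])
    (simp_all add: partial_theta_u)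

lemma induced_psi:
  assumes "p \<in> \<Omega>"
  shows "induced_metric (\<bullet>) \<psi> p $ 1 $ 1 = 1 + (\<partial> 1 u p)\<^sup>2"
    "induced_metric (\<bullet>) \<psi> p $ 1 $ 2 = \<partial> 1 u p * \<partial> 2 u p"
    "induced_metric (\<bullet>) \<psi> p $ 2 $ 1 = \<partial> 1 u p * \<partial> 2 u p"
    "induced_metric (\<bullet>) \<psi> p $ 2 $ 2 = 1 + (\<partial> 2 u p)\<^sup>2"
    "det (induced_metric (\<bullet>) \<psi> p) = (W p)\<^sup>2"
  using W_square[of p]
  by (simp_all add: induced_metric_def partial_psi[OF assms] inner_vec_def sum_3 axis_def power2_eq_square det_2 algebra_simps)

lemma induced_psi':
  assumes "p \<in> \<Omega>"
  shows "induced_metric lorentz \<psi>' p = (E p / W p)\<^sup>2 *\<^sub>R induced_metric (\<bullet>) \<psi> p"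
proof -
  have [simp]: "W p \<noteq> 0" using W_pos[of p] by simp
  have E: "E p = E p / W p * W p" by simp
  \<comment> \<open>With \<open>E p\<close> written as \<open>c * W p\<close>, the function
    \<open>W\<close> enters only through \<open>W p * W p\<close>, so \<open>W_square\<close> leaves
    a polynomial identity in the derivatives of \<open>u\<close>.\<close>
  define c where "c = E p / W p"
  have E: "E p = c * W p" by (simp add: c_def)
  have "induced_metric lorentz \<psi>' p $ i $ j = c\<^sup>2 * induced_metric (\<bullet>) \<psi> p $ i $ j" for i j
  proof -
    have l: "induced_metric lorentz \<psi>' p $ i $ j =
        \<partial> i (\<partial> 1 phi) p * \<partial> j (\<partial> 1 phi) p + \<partial> i (\<partial> 2 phi) p * \<partial> j (\<partial> 2 phi) p -
        c\<^sup>2 * (W p * W p) * (\<partial> i u p * \<partial> j u p)" for i j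
      by (simp add: induced_metric_def partial_psi'[OF assms] lorentz_def E power2_eq_square)
    show ?thesis
      using exhaust_2[of i] exhaust_2[of j]
      by (elim disjE) (simp_all add: l W_square hessian[OF assms, folded c_def] induced_psi[OF assms] power2_eq_square algebra_simps)
  qed
  then show ?thesis by (simp add: vec_eq_iff c_def)
qed

lemma smooth_N: "smooth_on \<Omega> N"
  unfolding N_def
  by (intro smooth_on_scaleR smooth_on_vector_3 smooth_on_uminus smooth_du smooth_on_const smooth_inverse_W open_domain)

lemma smooth_N': "smooth_on \<Omega> N'"
  unfolding N'_def by (intro smooth_on_vector_3 smooth_du smooth_W open_domain)

lemma partial_N': "p \<in> \<Omega> \<Longrightarrow> \<partial> i N' p = vector [\<partial> i (\<partial> 1 u) p, \<partial> i (\<partial> 2 u) p, \<partial> i W p]"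
  unfolding N'_def by (rule partial_vector_3[OF open_domain _ smooth_du smooth_du smooth_W])

text \<open>Differentiating the relation for \<open>W p * W p\<close> avoids the derivative of the
  root, and the product is what the Weingarten computation needs.\<close>

lemma partial_W:
  assumes p: "p \<in> \<Omega>"
  shows "W p * \<partial> i W p = \<partial> 1 u p * \<partial> i (\<partial> 1 u) p + \<partial> 2 u p * \<partial> i (\<partial> 2 u) p"
proof -
  note d = smooth_on_differentiable[OF smooth_W p] smooth_on_differentiable[OF smooth_du p]
  have m: "\<partial> i (\<lambda>q. f q * g q) p = f p * \<partial> i g p + \<partial> i f p * g p"
    if "f differentiable at p" "g differentiable at p" for f g :: "real^2 \<Rightarrow> real"
    by (rule partial_bilinear[OF bounded_bilinear_mult that])
  have md: "(\<lambda>q. \<partial> j u q * \<partial> j u q) differentiable at p" for j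
    by (rule frechet_derivative_bilinear(1)[OF bounded_bilinear_mult d(2) d(2)])
  have a: "\<partial> i (\<lambda>q. f q + g q) p = \<partial> i f p + \<partial> i g p"
    if "f differentiable at p" "g differentiable at p" for f g :: "real^2 \<Rightarrow> real"
    unfolding partial_deriv_def by (rule frechet_derivative_plus[OF that])
  have "\<partial> i (\<lambda>q. W q * W q) p = \<partial> i (\<lambda>q. 1 + (\<partial> 1 u q * \<partial> 1 u q + \<partial> 2 u q * \<partial> 2 u q)) p"
    by (simp add: W_square power2_eq_square add.assoc)
  also have "\<dots> = \<partial> i (\<lambda>q. \<partial> 1 u q * \<partial> 1 u q) p + \<partial> i (\<lambda>q. \<partial> 2 u q * \<partial> 2 u q) p"
    by (subst a) (auto simp: partial_const a md intro!: differentiable_add md)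
  finally show ?thesis by (simp add: m d)
qed

sublocale euclid: surface_with_normal "(\<bullet>)" 1 \<Omega> \<psi> N
proof (rule surface_with_normal.intro)
  show "w = 0" if "\<And>z. w \<bullet> z = 0" for w :: "real^3" using that[of w] by simp
next
  fix p assume p: "p \<in> \<Omega>"
  show "positive_definite (induced_metric (\<bullet>) \<psi> p)"
    using W_pos[of p] by (subst positive_definite_iff) (auto simp: induced_psi[OF p] add_pos_nonneg)
  show "N p \<bullet> \<partial> i \<psi> p = 0" for i
    using exhaust_2[of i] by (auto simp: N_def partial_psi[OF p] inner_vec_def sum_3 axis_def)
  have "N p \<bullet> N p = (1 / W p) * (1 / W p) * (W p * W p)"
    unfolding W_square by (simp add: N_def inner_vec_def sum_3 power2_eq_square algebra_simps)
  then show "N p \<bullet> N p = 1" using W_pos[of p] by simp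
  show "N differentiable at p" by (rule smooth_on_differentiable[OF smooth_N p])
qed (auto simp: open_domain bounded_bilinear_inner inner_commute smooth_psi)

lemma lorentz_normal:
  assumes p: "p \<in> \<Omega>"
  shows "lorentz (N' p) (\<partial> i \<psi>' p) = 0"
proof -
  have [simp]: "W p \<noteq> 0" using W_pos[of p] by simp
  define c where "c = E p / W p"
  have E: "E p = c * W p" by (simp add: c_def)
  have l: "lorentz (N' p) (\<partial> i \<psi>' p) = \<partial> 1 u p * \<partial> i (\<partial> 1 phi) p + \<partial> 2 u p * \<partial> i (\<partial> 2 phi) p -
      c * (W p * W p) * \<partial> i u p" for i
    by (simp add: lorentz_def N'_def partial_psi'[OF p] E)
  show ?thesis
    using exhaust_2[of i]
    by (elim disjE) (simp_all add: l W_square hessian[OF p, folded c_def] power2_eq_square algebra_simps)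
qed

lemma lorentz_unit: "lorentz (N' p) (N' p) = -1"
  using W_square[of p] by (simp add: lorentz_def N'_def power2_eq_square)

lemma induced_psi'_components:
  assumes p: "p \<in> \<Omega>"
  shows "induced_metric lorentz \<psi>' p $ i $ j = (E p / W p)\<^sup>2 * induced_metric (\<bullet>) \<psi> p $ i $ j"
    "det (induced_metric lorentz \<psi>' p) = (E p)^4 / (W p)\<^sup>2"
proof -
  show *: "induced_metric lorentz \<psi>' p $ i $ j = (E p / W p)\<^sup>2 * induced_metric (\<bullet>) \<psi> p $ i $ j" for i j
    by (simp add: induced_psi'[OF p])
  have "det (induced_metric lorentz \<psi>' p) = (E p / W p)^4 * det (induced_metric (\<bullet>) \<psi> p)"
    by (simp only: det_2 *) (simp add: algebra_simps power4_eq_xxxx power2_eq_square)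
  then show "det (induced_metric lorentz \<psi>' p) = (E p)^4 / (W p)\<^sup>2"
    using W_pos[of p] by (simp add: induced_psi[OF p] power_divide power4_eq_xxxx power2_eq_square)
qed

sublocale lorentzian: surface_with_normal lorentz "-1" \<Omega> \<psi>' N'
proof (rule surface_with_normal.intro)
  show "w = 0" if "\<And>z. lorentz w z = 0" for w using lorentz_nondegenerate that .
next
  fix p assume p: "p \<in> \<Omega>"
  show "positive_definite (induced_metric lorentz \<psi>' p)"
    using W_pos[of p] E_pos[of p]
    by (subst positive_definite_iff) (auto simp: induced_psi'_components[OF p] induced_psi[OF p] add_pos_nonneg)
  show "N' differentiable at p" by (rule smooth_on_differentiable[OF smooth_N' p])
qed (auto simp: open_domain lorentz_bilinear lorentz_commute smooth_psi' lorentz_normal lorentz_unit)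

section \<open>Second fundamental forms and the curvature relations\<close>

lemma euclid_h: "p \<in> \<Omega> \<Longrightarrow> euclid.h p $ i $ j = \<partial> i (\<partial> j u) p / W p"
  unfolding euclid.h_def by (simp add: partial2_psi inner_vec_def sum_3 N_def)

text \<open>Read off from the Weingarten equation, which involves second derivatives of
  \<open>phi\<close> and \<open>u\<close> only; second derivatives of \<open>\<psi>'\<close> would
  bring in third derivatives of \<open>phi\<close>.\<close>

lemma lorentzian_h:
  assumes p: "p \<in> \<Omega>"
  shows "lorentzian.h p $ i $ j = - (E p / W p) * \<partial> i (\<partial> j u) p"
proof -
  have [simp]: "W p \<noteq> 0" using W_pos[of p] by simp
  define c where "c = E p / W p"
  have E: "E p = c * W p" by (simp add: c_def)
  have "- lorentzian.h p $ i $ j = \<partial> i (\<partial> 1 u) p * \<partial> j (\<partial> 1 phi) p + \<partial> i (\<partial> 2 u) p * \<partial> j (\<partial> 2 phi) p -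
      c * (W p * \<partial> i W p) * \<partial> j u p"
    unfolding lorentzian.weingarten[OF p, symmetric]
    by (simp add: lorentz_def partial_N'[OF p] partial_psi'[OF p] E)
  \<comment> \<open>The rank one part of the Hessian of \<open>phi\<close> contributes
    \<open>c * (W p * \<partial> i W p) * \<partial> j u p\<close>, which the timelike term removes;
    the identity part leaves the Hessian of \<open>u\<close>.\<close>
  also have "\<dots> = c * \<partial> i (\<partial> j u) p"
    unfolding partial_W[OF p] using exhaust_2[of j]
    by (elim disjE) (simp_all add: hessian[OF p, folded c_def] power2_eq_square algebra_simps)
  finally show ?thesis by (simp add: c_def)
qed

text \<open>The metric is multiplied by \<open>(E p / W p)^2\<close> and \<open>h\<close> by
  \<open>- E p\<close>; the trace is therefore multiplied by the quotient of the two
  factors.\<close>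

lemma H_relation:
  assumes p: "p \<in> \<Omega>"
  shows "lorentzian.H p = - (W p)\<^sup>2 / E p * euclid.H p"
proof -
  have [simp]: "W p \<noteq> 0" "E p \<noteq> 0" using W_pos[of p] E_pos[of p] by simp_all
  have d: "det (induced_metric (\<bullet>) \<psi> p) \<noteq> 0" "det (induced_metric lorentz \<psi>' p) \<noteq> 0"
    by (simp_all add: induced_psi[OF p] induced_psi'_components[OF p])
  show ?thesis
    unfolding lorentzian.H_def euclid.H_def
    by (simp add: sum_2 matrix_inv_2[OF d(1)] matrix_inv_2[OF d(2)] induced_psi'_components[OF p]
        euclid_h[OF p] lorentzian_h[OF p] induced_psi(5)[OF p])
      (simp add: field_simps power2_eq_square power4_eq_xxxx)
qed

lemma mean_curvature_relation:
  "p \<in> \<Omega> \<Longrightarrow> mean_curvature \<psi>' N' p + (W p)\<^sup>2 * exp (- varphi (u p)) * mean_curvature \<psi> N p = 0"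
  by (simp add: euclid.mean_curvature_eq lorentzian.mean_curvature_eq H_relation exp_minus E_def divide_inverse)

text \<open>The determinant of \<open>h\<close> gains the factor \<open>(E p)^2\<close>, that of the
  metric \<open>(E p / W p)^4\<close>; the sign is the Lorentzian \<open>\<epsilon> = -1\<close> in
  the Gauss equation.\<close>

lemma gauss_curvature_relation:
  assumes p: "p \<in> \<Omega>"
  shows "gauss_curvature (induced_metric lorentz \<psi>') p +
    (W p)^4 * exp (- 2 * varphi (u p)) * gauss_curvature (induced_metric (\<bullet>) \<psi>) p = 0"
proof -
  have [simp]: "W p \<noteq> 0" "E p \<noteq> 0" using W_pos[of p] E_pos[of p] by simp_all
  have "exp (- 2 * varphi (u p)) = exp (- varphi (u p)) * exp (- varphi (u p))"
    by (simp flip: exp_add)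
  then have e: "exp (- 2 * varphi (u p)) = 1 / (E p * E p)"
    by (simp add: E_def exp_minus divide_inverse)
  show ?thesis
    unfolding e euclid.gauss_equation[OF p] lorentzian.gauss_equation[OF p]
    by (simp add: det_2[of "euclid.h p"] det_2[of "lorentzian.h p"] euclid_h[OF p] lorentzian_h[OF p]
        induced_psi(5)[OF p] induced_psi'_components(2)[OF p])
      (simp add: field_simps power2_eq_square power4_eq_xxxx)
qed

lemma conformal: "conformal_metrics \<Omega> (induced_metric (\<bullet>) \<psi>) (induced_metric lorentz \<psi>')"
  unfolding conformal_metrics_def
proof (intro exI[of _ "\<lambda>p. (E p * (1 / W p)) * (E p * (1 / W p))"] conjI ballI)
  show "smooth_on \<Omega> (\<lambda>p. (E p * (1 / W p)) * (E p * (1 / W p)))"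
    by (intro smooth_on_mult smooth_E smooth_inverse_W open_domain)
  fix p assume "p \<in> \<Omega>"
  then show "induced_metric lorentz \<psi>' p = ((E p * (1 / W p)) * (E p * (1 / W p))) *\<^sub>R induced_metric (\<bullet>) \<psi> p"
    by (simp add: induced_psi' power2_eq_square)
  show "0 < (E p * (1 / W p)) * (E p * (1 / W p))" using W_pos[of p] E_pos[of p] by simp
qed

lemma gauss_map: "is_gauss_map lorentz \<Omega> \<psi>' N'"
  unfolding is_gauss_map_def using W_pos
  by (auto simp: lorentz_unit lorentzian.frechet lorentzian.B_simps lorentz_normal) (simp add: N'_def W_pos)

section \<open>The transformed potential and the maximal equation\<close>

lemma theta_inverse:
  shows "open (\<theta> ` I)" "is_interval (\<theta> ` I)" "inj_on \<theta> I"
    "smooth_on (\<theta> ` I) (\<lambda>t. - varphi (inv_into I \<theta> t))"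
    "\<And>t. t \<in> I \<Longrightarrow> frechet_derivative (\<lambda>t. - varphi (inv_into I \<theta> t)) (at (\<theta> t)) 1 =
       - frechet_derivative varphi (at t) 1 / exp (varphi t)"
proof -
  have "\<theta> s < \<theta> t" if "s \<in> I" "t \<in> I" "s < t" for s t
  proof (rule DERIV_pos_imp_increasing[OF that(3)])
    fix x assume "s \<le> x" "x \<le> t"
    then have "x \<in> I" using that interval_I unfolding is_interval_1 by blast
    then show "\<exists>y. (\<theta> has_real_derivative y) (at x) \<and> 0 < y"
      by (intro exI[of _ "exp (varphi x)"] conjI theta) simp_all
  qed
  then show inj: "inj_on \<theta> I" by (metis inj_onI less_irrefl linorder_neqE_linordered_idom)
  have cont: "continuous_on I \<theta>"
    using theta by (meson DERIV_isCont continuous_at_imp_continuous_on)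
  show "is_interval (\<theta> ` I)"
    using interval_I connected_continuous_image[OF cont] by (simp add: is_interval_connected_1)
  \<comment> \<open>Division by the derivative of \<open>\<theta>\<close>, written with
    \<open>exp (- varphi t)\<close> so that its smoothness follows by composition.\<close>
  define R :: "real \<Rightarrow> real \<Rightarrow> real" where "R = (\<lambda>t v. v * exp (- varphi t))"
  have s: "smooth_on I (\<lambda>t. - varphi t)" by (rule smooth_on_uminus[OF open_I smooth_varphi])
  have d: "(\<theta> has_derivative (*) (exp (varphi t))) (at t)" if "t \<in> I" for t
    using has_field_derivative_imp_has_derivative[OF theta[OF that]] .
  have 1: "(*) (exp (varphi t)) \<circ> R t = id" for t
    by (auto simp: R_def fun_eq_iff exp_minus)
  have 2: "smooth_on I (\<lambda>t. R t v)" for v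
    unfolding R_def by (intro smooth_on_mult smooth_on_const open_I smooth_on_real_compose[OF open_I smooth_on_exp] s) auto
  note inv = smooth_on_inverse_function[OF open_I inj d 1 2 s, simplified]
  show "open (\<theta> ` I)" "smooth_on (\<theta> ` I) (\<lambda>t. - varphi (inv_into I \<theta> t))" by (fact inv(1,2))+
  fix t assume t: "t \<in> I"
  have v: "(varphi has_derivative frechet_derivative varphi (at t)) (at (inv_into I \<theta> (\<theta> t)))"
    using smooth_on_differentiable[OF smooth_varphi t] t inj by (simp add: frechet_derivative_works)
  have l: "linear (frechet_derivative varphi (at t))" using v by (rule has_derivative_linear)
  have "((\<lambda>t. - varphi (inv_into I \<theta> t)) has_derivative (\<lambda>x. - frechet_derivative varphi (at t) (R t x))) (at (\<theta> t))"
    using has_derivative_minus[OF diff_chain_at[OF inv(3)[OF t] v]] by (simp add: o_def)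
  from frechet_derivative_eqI[OF this]
  have "frechet_derivative (\<lambda>t. - varphi (inv_into I \<theta> t)) (at (\<theta> t)) 1 = - frechet_derivative varphi (at t) (R t 1)"
    by simp
  also have "\<dots> = - frechet_derivative varphi (at t) 1 / exp (varphi t)"
    using linear_scale[OF l, of "exp (- varphi t)" 1] by (simp add: R_def exp_minus divide_inverse mult.commute)
  finally show "frechet_derivative (\<lambda>t. - varphi (inv_into I \<theta> t)) (at (\<theta> t)) 1 =
       - frechet_derivative varphi (at t) 1 / exp (varphi t)" .
qed

text \<open>Both sides of the minimal equation are multiples of the nonzero vector
  \<open>N p\<close>, so it is a single scalar equation; the factor \<open>1 / W p\<close> is the
  third coordinate of \<open>N p\<close>.\<close>

lemma minimal_mean_curvature:
  assumes "minimal_surface I varphi \<Omega> \<psi>" and p: "p \<in> \<Omega>"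
  shows "euclid.H p = frechet_derivative varphi (at (u p)) 1 / W p"
proof -
  have d: "varphi differentiable at (\<psi> p $ 3)"
    using smooth_on_differentiable[OF smooth_varphi u_I[OF p]] by (simp add: \<psi>_def)
  have "mean_curvature_vector (\<bullet>) \<psi> p = normal_part (\<bullet>) \<psi> p (ambient_gradient (\<bullet>) (\<lambda>x. varphi (x $ 3)) (\<psi> p))"
    using assms unfolding minimal_surface_def weighted_extremal_def by blast
  then have "euclid.H p *\<^sub>R N p = (vector [0, 0, frechet_derivative varphi (at (u p)) 1] \<bullet> N p) *\<^sub>R N p"
    by (simp add: euclid.mean_curvature_vector_eq[OF p] euclid.normal_part_eq[OF p] ambient_gradient_height[OF d])
      (simp add: \<psi>_def)
  moreover have "N p \<noteq> 0" using euclid.unit[OF p] by auto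
  moreover have "vector [0, 0, d] \<bullet> N p = d / W p" for d
    by (simp add: inner_vec_def sum_3 N_def)
  ultimately show ?thesis by simp
qed

text \<open>Both vectors are \<open>W p / E p\<close> times the derivative of \<open>varphi\<close>
  times \<open>N' p\<close>. On the left, \<open>\<epsilon>\<close> cancels the sign in
  \<open>H_relation\<close>. On the right four signs cancel: \<open>\<epsilon>\<close>, the
  potential, the Lorentz gradient and the third term of \<open>lorentz\<close>; the factor
  \<open>1 / E p\<close> comes from differentiating the inverse of \<open>\<theta>\<close>.\<close>

lemma maximal:
  assumes "minimal_surface I varphi \<Omega> \<psi>"
  shows "maximal_spacelike_surface (\<theta> ` I) (\<lambda>t. - varphi (inv_into I \<theta> t)) \<Omega> \<psi>'"
  unfolding maximal_spacelike_surface_def weighted_extremal_def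
proof (intro conjI ballI theta_inverse smooth_psi')
  fix p assume p: "p \<in> \<Omega>"
  show "positive_definite (induced_metric lorentz \<psi>' p)" by (rule lorentzian.positive[OF p])
  show t: "\<psi>' p $ 3 \<in> \<theta> ` I" using u_I[OF p] by (simp add: \<psi>'_def)
  have d: "(\<lambda>t. - varphi (inv_into I \<theta> t)) differentiable at (\<psi>' p $ 3)"
    by (rule smooth_on_differentiable[OF theta_inverse(4) t])
  have f: "frechet_derivative (\<lambda>t. - varphi (inv_into I \<theta> t)) (at (\<psi>' p $ 3)) 1 =
      - frechet_derivative varphi (at (u p)) 1 / E p"
    using theta_inverse(5)[OF u_I[OF p]] by (simp add: \<psi>'_def E_def)
  show "mean_curvature_vector lorentz \<psi>' p =
      normal_part lorentz \<psi>' p (ambient_gradient lorentz (\<lambda>x. - varphi (inv_into I \<theta> (x $ 3))) (\<psi>' p))"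
    using W_pos[of p]
    unfolding lorentzian.mean_curvature_vector_eq[OF p] lorentzian.normal_part_eq[OF p] ambient_gradient_height(2)[OF d] f
      H_relation[OF p] minimal_mean_curvature[OF assms p]
    by (simp add: lorentz_def N'_def power2_eq_square)
qed

end

section \<open>Injectivity of the gradient and the graph property\<close>

text \<open>Convexity bounds the difference quotients along the segment by \<open>F y - F x\<close>.
  Only positive parameters are used, since \<open>C\<close> need not continue beyond
  \<open>x\<close>.\<close>

lemma convex_on_ge_tangent:
  fixes F :: "'a::real_normed_vector \<Rightarrow> real"
  assumes "convex_on C F" "x \<in> C" "y \<in> C" and L: "(F has_derivative L) (at x)"
  shows "F x + L (y - x) \<le> F y"
proof -
  have "((\<lambda>t. x + t *\<^sub>R (y - x)) has_derivative (\<lambda>t. t *\<^sub>R (y - x))) (at (0::real))"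
    by (auto intro!: derivative_eq_intros)
  from diff_chain_at[OF this, of F L] L
  have "((\<lambda>t. F (x + t *\<^sub>R (y - x))) has_derivative (\<lambda>t. L (t *\<^sub>R (y - x)))) (at 0)"
    by (simp add: o_def)
  then have "((\<lambda>t. F (x + t *\<^sub>R (y - x))) has_real_derivative L (y - x)) (at 0)"
    by (rule has_derivative_imp_has_field_derivative)
      (simp add: linear_scale[OF has_derivative_linear[OF L]])
  then have "(\<lambda>t. (F (x + t *\<^sub>R (y - x)) - F x) / t) \<midarrow>0\<rightarrow> L (y - x)"
    by (simp add: DERIV_def)
  then have lim: "((\<lambda>t. (F (x + t *\<^sub>R (y - x)) - F x) / t) \<longlongrightarrow> L (y - x)) (at_right 0)"
    by (rule filterlim_mono) (simp_all add: at_within_le_at)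
  have "\<forall>\<^sub>F t in at_right 0. (F (x + t *\<^sub>R (y - x)) - F x) / t \<le> F y - F x"
    unfolding eventually_at_right_field
  proof (intro exI[of _ 1] conjI allI impI)
    fix t :: real assume t: "0 < t" "t < 1"
    have "F ((1 - t) *\<^sub>R x + t *\<^sub>R y) \<le> (1 - t) * F x + t * F y"
      using convex_onD[OF assms(1), of t x y] t assms(2,3) by simp
    moreover have "(1 - t) *\<^sub>R x + t *\<^sub>R y = x + t *\<^sub>R (y - x)" by (simp add: algebra_simps)
    ultimately have "F (x + t *\<^sub>R (y - x)) - F x \<le> t * (F y - F x)" by (simp add: algebra_simps)
    then show "(F (x + t *\<^sub>R (y - x)) - F x) / t \<le> F y - F x" using t by (simp add: divide_simps mult.commute)
  qed simp
  from tendsto_upperbound[OF lim this] show ?thesis by simp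
qed

context hessian_system
begin

definition grad :: "real^2 \<Rightarrow> real^2" where "grad = (\<lambda>p. vector [\<partial> 1 phi p, \<partial> 2 phi p])"

definition hess :: "real^2 \<Rightarrow> real^2 \<Rightarrow> real^2" where
  "hess p v = (E p / W p) *\<^sub>R vector [(1 + (\<partial> 1 u p)\<^sup>2) * v$1 + \<partial> 1 u p * \<partial> 2 u p * v$2,
     \<partial> 1 u p * \<partial> 2 u p * v$1 + (1 + (\<partial> 2 u p)\<^sup>2) * v$2]"

text \<open>Adjugate of the Hessian matrix divided by its determinant, which is
  \<open>(E p)^2\<close>. Sums with negated terms and plain products are used so that the smoothness
  rules match directly.\<close>

definition hess_inv :: "real^2 \<Rightarrow> real^2 \<Rightarrow> real^2" where
  "hess_inv p v = ((1 / E p) * (1 / W p)) *\<^sub>R vector [(1 + \<partial> 2 u p * \<partial> 2 u p) * v$1 + - (\<partial> 1 u p * \<partial> 2 u p * v$2),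
     - (\<partial> 1 u p * \<partial> 2 u p * v$1) + (1 + \<partial> 1 u p * \<partial> 1 u p) * v$2]"

lemma smooth_grad: "smooth_on \<Omega> grad"
  unfolding grad_def by (intro smooth_on_vector_2 smooth_dphi open_domain)

lemma grad_has_derivative:
  assumes p: "p \<in> \<Omega>"
  shows "(grad has_derivative hess p) (at p)"
proof -
  have d: "grad differentiable at p" by (rule smooth_on_differentiable[OF smooth_grad p])
  have "\<partial> i grad p = vector [\<partial> i (\<partial> 1 phi) p, \<partial> i (\<partial> 2 phi) p]" for i
    unfolding grad_def by (rule partial_vector_2[OF open_domain p smooth_dphi smooth_dphi])
  then have "frechet_derivative grad (at p) = hess p"
    by (simp add: fun_eq_iff partial_eq_frechet[OF d] hess_def hessian[OF p] vec_eq_iff forall_2 algebra_simps add_divide_distrib)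
  then show ?thesis using d by (metis frechet_derivative_works)
qed

text \<open>The matrix is a positive multiple of the identity plus a rank one square.\<close>

lemma hess_positive:
  assumes "v \<noteq> 0"
  shows "hess p v \<bullet> v > 0"
proof -
  have "hess p v \<bullet> v = (E p / W p) * ((v$1)\<^sup>2 + (v$2)\<^sup>2 + (\<partial> 1 u p * v$1 + \<partial> 2 u p * v$2)\<^sup>2)"
    by (simp add: hess_def inner_vec_def sum_2 power2_eq_square algebra_simps add_divide_distrib)
  moreover have "(v$1)\<^sup>2 + (v$2)\<^sup>2 > 0"
    using assms by (simp add: vec_eq_iff forall_2 sum_power2_gt_zero_iff)
  ultimately show ?thesis using W_pos[of p] E_pos[of p] by (simp add: add_pos_nonneg)
qed

lemma hess_hess_inv: "hess p \<circ> hess_inv p = id"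
proof
  fix v
  have [simp]: "W p \<noteq> 0" "E p \<noteq> 0" using W_pos[of p] E_pos[of p] by simp_all
  let ?a = "\<partial> 1 u p" and ?b = "\<partial> 2 u p"
  have "hess p (hess_inv p v) = (1 / (W p * W p)) *\<^sub>R (1 + ?a\<^sup>2 + ?b\<^sup>2) *\<^sub>R v"
    by (simp add: hess_def hess_inv_def vec_eq_iff forall_2) (simp add: field_simps power2_eq_square)
  then show "(hess p \<circ> hess_inv p) v = id v" by (simp flip: W_square)
qed

lemma smooth_hess_inv: "smooth_on \<Omega> (\<lambda>p. hess_inv p v)"
  unfolding hess_inv_def
  by (intro smooth_on_scaleR smooth_on_vector_2 smooth_on_mult smooth_on_add smooth_on_uminus smooth_on_const
      smooth_du smooth_inverse_W smooth_on_inverse[OF open_domain smooth_E] E_pos open_domain)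

text \<open>Along the segment, the derivative of the component of \<open>grad\<close> in direction
  \<open>b - a\<close> is the positive Hessian form. The segment has to stay in
  \<open>\<Omega>\<close>; this is where the shape of the domain enters.\<close>

lemma grad_strictly_monotone:
  assumes "closed_segment a b \<subseteq> \<Omega>" "a \<noteq> b"
  shows "(grad b - grad a) \<bullet> (b - a) > 0"
proof -
  define k where "k = (\<lambda>t. grad (a + t *\<^sub>R (b - a)) \<bullet> (b - a))"
  have "k 0 < k 1"
  proof (rule DERIV_pos_imp_increasing[OF zero_less_one])
    fix t :: real assume t: "0 \<le> t" "t \<le> 1"
    let ?x = "a + t *\<^sub>R (b - a)"
    have "?x \<in> closed_segment a b" using t by (auto simp: in_segment algebra_simps intro!: exI[of _ t])
    then have x: "(grad has_derivative hess ?x) (at ?x)" using assms grad_has_derivative by blast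
    have "((\<lambda>t. a + t *\<^sub>R (b - a)) has_derivative (\<lambda>t. t *\<^sub>R (b - a))) (at t)"
      by (auto intro!: derivative_eq_intros)
    from has_derivative_inner_left[OF diff_chain_at[OF this x], of "b - a"]
    have "(k has_derivative (\<lambda>s. hess ?x (s *\<^sub>R (b - a)) \<bullet> (b - a))) (at t)"
      by (simp add: o_def k_def)
    then have "(k has_real_derivative hess ?x (b - a) \<bullet> (b - a)) (at t)"
      by (rule has_derivative_imp_has_field_derivative)
        (simp add: linear_scale[OF has_derivative_linear[OF x]])
    then show "\<exists>y. (k has_real_derivative y) (at t) \<and> 0 < y" using hess_positive assms(2) by auto
  qed
  then show ?thesis by (simp add: k_def inner_diff_left)
qed

lemma inj_on_grad_convex:
  assumes "convex U" "U \<subseteq> \<Omega>"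
  shows "inj_on grad U"
proof (rule inj_onI, rule ccontr)
  fix a b assume "a \<in> U" "b \<in> U" "grad a = grad b" "a \<noteq> b"
  moreover from this have "closed_segment a b \<subseteq> \<Omega>" using assms convex_contains_segment by blast
  ultimately show False using grad_strictly_monotone[of a b] by simp
qed

lemma phi_has_derivative:
  assumes p: "p \<in> \<Omega>"
  shows "(phi has_derivative (\<lambda>v. grad p \<bullet> v)) (at p)"
proof -
  have d: "phi differentiable at p" using phi_C2 p by (simp add: numeral_2_eq_2)
  have "frechet_derivative phi (at p) = (\<lambda>v. grad p \<bullet> v)"
    by (simp add: fun_eq_iff partial_eq_frechet[OF d] grad_def inner_vec_def sum_2 mult.commute)
  then show ?thesis using d by (metis frechet_derivative_works)
qed

text \<open>If \<open>\<nabla>\<phi>\<close> agreed at \<open>a\<close> and \<open>b\<close>, the convex extension would be affine on the segment from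
  \<open>a\<close> to \<open>b\<close>, contradicting the strict monotonicity of \<open>\<nabla>\<phi>\<close> close to \<open>a\<close>.\<close>

lemma inj_on_grad_convex_function:
  assumes "convex_function \<Omega> phi"
  shows "inj_on grad \<Omega>"
proof (rule inj_onI, rule ccontr)
  fix a b assume ab: "a \<in> \<Omega>" "b \<in> \<Omega>" "grad a = grad b" "a \<noteq> b"
  obtain F where F: "convex_on (convex hull \<Omega>) F" "\<And>p. p \<in> \<Omega> \<Longrightarrow> F p = phi p"
    using assms unfolding convex_function_def by blast
  have tangent: "F x + grad x \<bullet> (y - x) \<le> F y" if "x \<in> \<Omega>" "y \<in> \<Omega>" for x y
  proof (rule convex_on_ge_tangent[OF F(1)])
    show "x \<in> convex hull \<Omega>" "y \<in> convex hull \<Omega>" using that hull_subset by fast+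
    show "(F has_derivative (\<lambda>v. grad x \<bullet> v)) (at x)"
      by (rule has_derivative_transform_within_open[OF phi_has_derivative[OF that(1)] open_domain that(1)])
        (simp add: F(2))
  qed
  obtain \<delta> where \<delta>: "\<delta> > 0" "ball a \<delta> \<subseteq> \<Omega>" using open_domain ab(1) open_contains_ball by blast
  \<comment> \<open>Small enough for \<open>c\<close> to lie in the ball around \<open>a\<close>,
    where segments stay in \<open>\<Omega>\<close>; the bound \<open>1 / 2\<close> keeps
    \<open>c\<close> strictly between \<open>a\<close> and \<open>b\<close>.\<close>
  define t where "t = min (1 / 2) (\<delta> / norm (b - a) / 2)"
  have n: "norm (b - a) > 0" using ab(4) by simp
  have t: "0 < t" "t < 1" using n \<delta>(1) by (auto simp: t_def)
  have "t * norm (b - a) \<le> \<delta> / norm (b - a) / 2 * norm (b - a)"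
    by (intro mult_right_mono) (auto simp: t_def)
  also have "\<dots> < \<delta>" using n \<delta>(1) by simp
  finally have tn: "t * norm (b - a) < \<delta>" .
  define c where "c = a + t *\<^sub>R (b - a)"
  have "c \<in> ball a \<delta>" using tn t by (simp add: c_def dist_norm)
  moreover have "a \<in> ball a \<delta>" using \<delta>(1) by simp
  ultimately have seg: "closed_segment a c \<subseteq> \<Omega>"
    using \<delta>(2) convex_contains_segment[of "ball a \<delta>"] by blast
  then have c: "c \<in> \<Omega>" by auto
  have "(grad c - grad a) \<bullet> (c - a) > 0"
    using grad_strictly_monotone[OF seg] t ab(4) by (simp add: c_def)
  then have "t * ((grad c - grad a) \<bullet> (b - a)) > 0" by (simp add: c_def)
  then have mono: "grad c \<bullet> (b - a) > grad a \<bullet> (b - a)"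
    using t by (simp add: zero_less_mult_iff inner_diff_left)
  have bc: "b - c = (1 - t) *\<^sub>R (b - a)" by (simp add: c_def algebra_simps)
  \<comment> \<open>Tangent inequalities from \<open>c\<close> to \<open>b\<close>, from
    \<open>a\<close> to \<open>c\<close> and from \<open>b\<close> to \<open>a\<close>. The values
    of \<open>F\<close> cancel in their sum, which bounds the slope at \<open>c\<close> by that at
    \<open>a\<close>.\<close>
  have "F c + (1 - t) * (grad c \<bullet> (b - a)) \<le> F b"
    using tangent[OF c ab(2)] by (simp only: bc inner_scaleR_right)
  moreover have "F a + t * (grad a \<bullet> (b - a)) \<le> F c"
    using tangent[OF ab(1) c] by (simp add: c_def)
  moreover have "F b - grad a \<bullet> (b - a) \<le> F a"
    using tangent[OF ab(2,1)] ab(3) by (simp add: inner_diff_right)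
  ultimately have "(1 - t) * (grad c \<bullet> (b - a) - grad a \<bullet> (b - a)) \<le> 0"
    by (simp add: algebra_simps)
  moreover have "(1 - t) * (grad c \<bullet> (b - a) - grad a \<bullet> (b - a)) > 0"
    using t mono by simp
  ultimately show False by simp
qed

text \<open>The horizontal part of \<open>\<psi>'\<close> is \<open>grad\<close>, so the height
  function must be \<open>\<theta>\<close> after \<open>u\<close> after the inverse of
  \<open>grad\<close>; \<open>hess_inv\<close> is the derivative of that inverse.\<close>

lemma vertical_graph:
  assumes U: "open U" "connected U" "U \<noteq> {}" "U \<subseteq> \<Omega>" "inj_on grad U"
  shows "\<exists>f. vertical_graph_over (legendre_domain U phi) f U \<psi>'"
proof -
  have D: "legendre_domain U phi = grad ` U" by (simp add: legendre_domain_def grad_def)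
  have P: "vector [\<psi>' p $ 1, \<psi>' p $ 2] = grad p" for p by (simp add: \<psi>'_def grad_def)
  have d: "\<And>x. x \<in> U \<Longrightarrow> (grad has_derivative hess x) (at x)" using grad_has_derivative U(4) by blast
  have R: "\<And>v. smooth_on U (\<lambda>x. hess_inv x v)" using smooth_on_subset[OF smooth_hess_inv U(4)] .
  have k: "smooth_on U (\<lambda>p. \<theta> (u p))" using smooth_on_subset[OF smooth_theta_u U(4)] .
  note inv = smooth_on_inverse_function[OF U(1,5) d hess_hess_inv R k, simplified]
  have cont: "continuous_on U grad"
    using d by (meson continuous_at_imp_continuous_on has_derivative_continuous)
  have "vertical_graph_over (grad ` U) (\<lambda>y. \<theta> (u (inv_into U grad y))) U \<psi>'"
    unfolding vertical_graph_over_def planar_domain_def P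
  proof (intro conjI ballI)
    show "connected (grad ` U)" by (rule connected_continuous_image[OF cont U(2)])
    show "bij_betw grad U (grad ` U)" using U(5) by (rule inj_on_imp_bij_betw)
    show "\<psi>' p $ 3 = \<theta> (u (inv_into U grad (grad p)))" if "p \<in> U" for p
      using that U(5) by (simp add: \<psi>'_def)
  qed (use inv(1,2) U(3) in auto)
  then show ?thesis unfolding D by blast
qed

text \<open>A ball is convex, so \<open>grad\<close> is injective on it.\<close>

lemma local_vertical_graph:
  assumes "p \<in> \<Omega>"
  shows "\<exists>U f. open U \<and> p \<in> U \<and> U \<subseteq> \<Omega> \<and> vertical_graph_over (legendre_domain U phi) f U \<psi>'"
proof -
  obtain \<delta> where \<delta>: "\<delta> > 0" "ball p \<delta> \<subseteq> \<Omega>" using open_domain assms open_contains_ball by blast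
  have "\<exists>f. vertical_graph_over (legendre_domain (ball p \<delta>) phi) f (ball p \<delta>) \<psi>'"
    by (rule vertical_graph) (use \<delta> in \<open>auto simp: inj_on_grad_convex connected_ball\<close>)
  with \<delta> show ?thesis by (meson centre_in_ball open_ball)
qed

end

text \<open>The graph claim amounts to injectivity of the gradient map, which positivity of the
  Hessian gives along segments inside the domain. It is therefore stated near every point, and
  globally when the domain or \<open>phi\<close> is convex. The inverse of the primitive is taken on
  \<open>I\<close>, where \<open>\<theta>\<close> is strictly increasing.\<close>

theorem theorem4p1:
  fixes I :: "real set"
    and varphi \<theta> :: "real \<Rightarrow> real"
    and \<Omega>\<^sub>1 :: "(real^2) set"
    and u W phi :: "real^2 \<Rightarrow> real"
    and \<psi> \<psi>' N N' :: "real^2 \<Rightarrow> real^3"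
  assumes domain: "planar_domain \<Omega>\<^sub>1" "simply_connected \<Omega>\<^sub>1"
    and psi: "\<psi> = (\<lambda>p. vector [p $ 1, p $ 2, u p])"
    and minimal: "minimal_surface I varphi \<Omega>\<^sub>1 \<psi>"
    and W: "W = (\<lambda>p. sqrt (1 + (\<partial> 1 u p)\<^sup>2 + (\<partial> 2 u p)\<^sup>2))"
    and phi_C2: "Ck_on 2 \<Omega>\<^sub>1 phi"
    and phi_xx: "\<And>p. p \<in> \<Omega>\<^sub>1 \<Longrightarrow>
          \<partial> 1 (\<partial> 1 phi) p = (1 + (\<partial> 1 u p)\<^sup>2) / W p * exp (varphi (u p))"
    and phi_xy: "\<And>p. p \<in> \<Omega>\<^sub>1 \<Longrightarrow>
          \<partial> 2 (\<partial> 1 phi) p = \<partial> 1 u p * \<partial> 2 u p / W p * exp (varphi (u p))"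
    and phi_yy: "\<And>p. p \<in> \<Omega>\<^sub>1 \<Longrightarrow>
          \<partial> 2 (\<partial> 2 phi) p = (1 + (\<partial> 2 u p)\<^sup>2) / W p * exp (varphi (u p))"
    and theta: "\<And>t. t \<in> I \<Longrightarrow> (\<theta> has_real_derivative exp (varphi t)) (at t)"
    and psi': "\<psi>' = (\<lambda>p. vector [\<partial> 1 phi p, \<partial> 2 phi p, \<theta> (u p)])"
    and N: "N = (\<lambda>p. (1 / W p) *\<^sub>R vector [- \<partial> 1 u p, - \<partial> 2 u p, 1])"
    and N': "N' = (\<lambda>p. vector [\<partial> 1 u p, \<partial> 2 u p, W p])"
  shows "maximal_spacelike_surface (\<theta> ` I) (\<lambda>t. - varphi (inv_into I \<theta> t)) \<Omega>\<^sub>1 \<psi>' \<and>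
    (\<forall>p\<in>\<Omega>\<^sub>1. \<exists>U f. open U \<and> p \<in> U \<and> U \<subseteq> \<Omega>\<^sub>1 \<and>
       vertical_graph_over (legendre_domain U phi) f U \<psi>') \<and>
    (convex \<Omega>\<^sub>1 \<or> convex_function \<Omega>\<^sub>1 phi \<longrightarrow>
       (\<exists>f. vertical_graph_over (legendre_domain \<Omega>\<^sub>1 phi) f \<Omega>\<^sub>1 \<psi>')) \<and>
    is_gauss_map lorentz \<Omega>\<^sub>1 \<psi>' N' \<and>
    conformal_metrics \<Omega>\<^sub>1 (induced_metric (\<bullet>) \<psi>) (induced_metric lorentz \<psi>') \<and>
    (\<forall>p\<in>\<Omega>\<^sub>1. mean_curvature \<psi>' N' p + (W p)\<^sup>2 * exp (- varphi (u p)) * mean_curvature \<psi> N p = 0) \<and>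
    (\<forall>p\<in>\<Omega>\<^sub>1. gauss_curvature (induced_metric lorentz \<psi>') p +
       (W p)^4 * exp (- 2 * varphi (u p)) * gauss_curvature (induced_metric (\<bullet>) \<psi>) p = 0)"
proof -
  have m: "open I" "is_interval I" "smooth_on I varphi" "smooth_on \<Omega>\<^sub>1 \<psi>" "\<And>p. p \<in> \<Omega>\<^sub>1 \<Longrightarrow> \<psi> p $ 3 \<in> I"
    using minimal unfolding minimal_surface_def weighted_extremal_def by blast+
  have \<Omega>: "open \<Omega>\<^sub>1" "connected \<Omega>\<^sub>1" "\<Omega>\<^sub>1 \<noteq> {}" using domain(1) by (auto simp: planar_domain_def)
  interpret S: hessian_system I varphi \<theta> \<Omega>\<^sub>1 u phi W
  proof (rule hessian_system.intro[OF m(1-3) \<Omega>(1) _ _ W phi_C2 phi_xx phi_xy phi_yy theta])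
    show "smooth_on \<Omega>\<^sub>1 u"
      using smooth_on_linear[OF \<Omega>(1) bounded_linear_vec_nth[of 3] m(4)] by (simp add: psi)
    show "u p \<in> I" if "p \<in> \<Omega>\<^sub>1" for p using m(5)[OF that] by (simp add: psi)
  qed
  have e: "S.\<psi> = \<psi>" "S.\<psi>' = \<psi>'" "S.N = N" "S.N' = N'"
    unfolding S.\<psi>_def S.\<psi>'_def S.N_def S.N'_def psi psi' N N' by (rule refl)+
  have "convex \<Omega>\<^sub>1 \<or> convex_function \<Omega>\<^sub>1 phi \<Longrightarrow> inj_on S.grad \<Omega>\<^sub>1"
    using S.inj_on_grad_convex S.inj_on_grad_convex_function by blast
  then show ?thesis
    using S.maximal[unfolded e, OF minimal] S.local_vertical_graph[unfolded e]
      S.vertical_graph[unfolded e, OF \<Omega> subset_refl] S.gauss_map[unfolded e] S.conformal[unfolded e]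
      S.mean_curvature_relation[unfolded e] S.gauss_curvature_relation[unfolded e]
    by blast
qed

end
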